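(* Let $G^+$ be a Garside monoid of spherical type with Garside element $\Delta$, and let $\alpha,\beta$ be the exponential growth rates of $|\mathrm{PSeq}_k|$ and $|G^+_{(k)}|$. For each $k$ let $\nu_k$ be the uniform probability measure on $G^+_{(k)}$, and let $\mu_{\mathcal A}$ be the uniform probability measure on the set $\mathcal A$ of atoms of $G^+$. If $\alpha<\beta$, then the expected value $\mathbf{E}_{\nu_k\times\mu_{\mathcal A}}[\mathrm{pd}]$ of the penetration distance with respect to $\nu_k\times\mu_{\mathcal A}$ is uniformly bounded, that is, there is a constant $C$ independent of $k$ such that $\mathbf{E}_{\nu_k\times\mu_{\mathcal A}}[\mathrm{pd}]\le C$ for all $k$.
   Context: Garside monoids. In a cancellative monoid $M$ with unit $\mathbf 1$ write $x\preccurlyeq y$ if $xc=y$ for some $c\in M$, and $x\succcurlyeq y$ if $x=cy$ for some $c\in M$. An element $s$ is an atom if $s=ab$ implies $a=\mathbf 1$ or $b=\mathbf 1$ (atoms are understood to be $\ne\mathbf 1$); $\mathcal A$ is the set of atoms. $M$ is a Garside monoid of spherical type if it is a lattice with respect to both $\preccurlyeq$ and $\succcurlyeq$, has no strict infinite descending chains for either order, and there is $\Delta\in M$ (a Garside element, fixed) such that $\mathcal D=\{s: s\preccurlyeq\Delta\}=\{s:\Delta\succcurlyeq s\}$ is finite and generates $M$. Elements of $\mathcal D$ are the simple elements; $\mathcal D^{\circ}=\mathcal D\setminus\{\mathbf 1,\Delta\}$ is the set of proper simple elements. $x\wedge y$ denotes the gcd with respect to $\preccurlyeq$. For $s\in\mathcal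 D$, $\partial s\in\mathcal D$ is the unique element with $s\,\partial s=\Delta$. $M$ embeds in its group of fractions. Normal form. Every $x\in M$ can be written uniquely as $x=x_1\cdots x_m$ with $x_i\in\mathcal D\setminus\{\mathbf 1\}$ and $\partial x_i\wedge x_{i+1}=\mathbf 1$ for $1\le i<m$ (left normal form). It has the form $\Delta^{r}y_1\cdots y_l$ with $y_i\in\mathcal D^{\circ}$; put $\inf(x)=r$, $\mathrm{cl}(x)=l$. Set $G^+_{(k)}=\{x\in G^+:\mathrm{cl}(x)=k,\ \inf(x)=0\}$. Penetration distance. For $x,y\in G^+$, $$\mathrm{pd}(x,y)=\mathrm{cl}(x)-\max\{i\in\{0,\dots,\mathrm{cl}(x)\}: x\Delta^{-\inf(x)}\wedge\Delta^i=xy\Delta^{-\inf(xy)}\wedge\Delta^i\}.$$ Penetration sequences. A word $(s_k,m_k)\cdots(s_2,m_2)(s_1,m_1)$ over $\mathcal D^{\circ}\times\mathcal D^{\circ}$ is a penetration sequence of length $k$ if $m_1\preccurlyeq\partial s_1$ and, for all $1\le i<k$: $s_im_i\ne\Delta$, $\partial s_{i+1}\wedge s_i=\mathbf 1$, and $m_{i+1}=\partial s_{i+1}\wedge s_im_i$. $\mathrm{PSeq}_k$ is the set of penetration sequences of length $k$. Growth rates. $\alpha=\lim_{k\to\infty}|\mathrm{PSeq}_k|^{1/k}$ and $\beta=\lim_{k\to\infty}|G^+_{(k)}|^{1/k}$ (these limits exist). *)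

theory Defs
  imports "HOL-Probability.Probability"
begin

section \<open>Garside monoids of spherical type\<close>

definition left_divides :: "'a::monoid_mult \<Rightarrow> 'a \<Rightarrow> bool"  (infix "\<preceq>" 50)
  where "x \<preceq> y \<longleftrightarrow> (\<exists>c. x * c = y)"

definition right_divided_by :: "'a::monoid_mult \<Rightarrow> 'a \<Rightarrow> bool"  (infix "\<succeq>" 50)
  where "x \<succeq> y \<longleftrightarrow> (\<exists>c. x = c * y)"

definition lattice_order :: "('a \<Rightarrow> 'a \<Rightarrow> bool) \<Rightarrow> bool"
  where "lattice_order le \<longleftrightarrow>
    (\<exists>meet join. class.lattice meet le (\<lambda>x y. le x y \<and> \<not> le y x) join)"

definition simple_elements :: "'a::monoid_mult \<Rightarrow> 'a set"
  where "simple_elements \<Delta> = {s. s \<preceq> \<Delta>}"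

definition proper_simple_elements :: "'a::monoid_mult \<Rightarrow> 'a set"
  where "proper_simple_elements \<Delta> = simple_elements \<Delta> - {1, \<Delta>}"

definition atoms :: "'a::monoid_mult set"
  where "atoms = {s. s \<noteq> 1 \<and> (\<forall>a b. s = a * b \<longrightarrow> a = 1 \<or> b = 1)}"

locale garside_monoid =
  fixes \<Delta> :: "'a::monoid_mult"
  assumes left_cancel: "\<And>a b c :: 'a. a * b = a * c \<Longrightarrow> b = c"
    and right_cancel: "\<And>a b c :: 'a. b * a = c * a \<Longrightarrow> b = c"
    and left_lattice: "lattice_order (\<lambda>x y :: 'a. x \<preceq> y)"
    and right_lattice: "lattice_order (\<lambda>x y :: 'a. y \<succeq> x)"
    and left_noetherian: "\<nexists>f :: nat \<Rightarrow> 'a. \<forall>i. f (Suc i) \<preceq> f i \<and> f (Suc i) \<noteq> f i"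
    and right_noetherian: "\<nexists>f :: nat \<Rightarrow> 'a. \<forall>i. f i \<succeq> f (Suc i) \<and> f i \<noteq> f (Suc i)"
    and simple_left_right: "simple_elements \<Delta> = {s. \<Delta> \<succeq> s}"
    and finite_simple: "finite (simple_elements \<Delta>)"
    and simple_generate: "\<And>x :: 'a. \<exists>xs. set xs \<subseteq> simple_elements \<Delta> \<and> prod_list xs = x"


section \<open>Normal forms and penetration distance\<close>

definition left_gcd :: "'a::monoid_mult \<Rightarrow> 'a \<Rightarrow> 'a"
  where "left_gcd x y = (THE d. d \<preceq> x \<and> d \<preceq> y \<and> (\<forall>e. e \<preceq> x \<and> e \<preceq> y \<longrightarrow> e \<preceq> d))"

definition complement :: "'a::monoid_mult \<Rightarrow> 'a \<Rightarrow> 'a"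
  where "complement \<Delta> s = (THE t. s * t = \<Delta>)"

definition is_normal_form :: "'a::monoid_mult \<Rightarrow> 'a list \<Rightarrow> bool"
  where "is_normal_form \<Delta> xs \<longleftrightarrow>
    set xs \<subseteq> simple_elements \<Delta> - {1} \<and>
    successively (\<lambda>s t. left_gcd (complement \<Delta> s) t = 1) xs"

definition normal_form :: "'a::monoid_mult \<Rightarrow> 'a \<Rightarrow> 'a list"
  where "normal_form \<Delta> x = (THE xs. is_normal_form \<Delta> xs \<and> prod_list xs = x)"

text \<open>In a left normal form all factors \<open>\<Delta>\<close> precede the proper simple factors.\<close>

definition infimum :: "'a::monoid_mult \<Rightarrow> 'a \<Rightarrow> nat"
  where "infimum \<Delta> x = length (takeWhile (\<lambda>s. s = \<Delta>) (normal_form \<Delta> x))"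

definition canonical_length :: "'a::monoid_mult \<Rightarrow> 'a \<Rightarrow> nat"
  where "canonical_length \<Delta> x = length (dropWhile (\<lambda>s. s = \<Delta>) (normal_form \<Delta> x))"

definition length_sphere :: "'a::monoid_mult \<Rightarrow> nat \<Rightarrow> 'a set"
  where "length_sphere \<Delta> k = {x. canonical_length \<Delta> x = k \<and> infimum \<Delta> x = 0}"

text \<open>
  The element \<open>x \<Delta>\<^sup>-\<^sup>r\<close>, \<open>r = inf(x)\<close>, of the group of fractions. It lies in the monoid, as
  \<open>\<Delta>\<^sup>r\<close> divides \<open>x\<close> on the left and hence, left and right multiples of \<open>\<Delta>\<close> being the same, also
  on the right; so it is the unique element \<open>z\<close> of the monoid with \<open>z \<Delta>\<^sup>r = x\<close>.
\<close>

definition remove_Delta :: "'a::monoid_mult \<Rightarrow> 'a \<Rightarrow> 'a"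
  where "remove_Delta \<Delta> x = (THE z. z * \<Delta> ^ infimum \<Delta> x = x)"

text \<open>The set below contains \<open>0\<close> and is bounded by the canonical length, so the maximum exists
  and the subtraction does not truncate.\<close>

definition pd :: "'a::monoid_mult \<Rightarrow> 'a \<Rightarrow> 'a \<Rightarrow> nat"
  where "pd \<Delta> x y = canonical_length \<Delta> x -
    Max {i \<in> {0..canonical_length \<Delta> x}.
      left_gcd (remove_Delta \<Delta> x) (\<Delta> ^ i) = left_gcd (remove_Delta \<Delta> (x * y)) (\<Delta> ^ i)}"


section \<open>Penetration sequences and growth rates\<close>

text \<open>Lists are in written order \<open>[(s\<^sub>k, m\<^sub>k), \<dots>, (s\<^sub>1, m\<^sub>1)]\<close>, so the head carries the largest
  index; in the condition on neighbours, \<open>(s', m')\<close> is \<open>(s\<^sub>i\<^sub>+\<^sub>1, m\<^sub>i\<^sub>+\<^sub>1)\<close> and \<open>(s, m)\<close> is \<open>(s\<^sub>i, m\<^sub>i)\<close>.\<close>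

definition is_penetration_sequence :: "'a::monoid_mult \<Rightarrow> ('a \<times> 'a) list \<Rightarrow> bool"
  where "is_penetration_sequence \<Delta> w \<longleftrightarrow>
    set w \<subseteq> proper_simple_elements \<Delta> \<times> proper_simple_elements \<Delta> \<and>
    (w \<noteq> [] \<longrightarrow> snd (last w) \<preceq> complement \<Delta> (fst (last w))) \<and>
    successively (\<lambda>(s', m') (s, m).
      s * m \<noteq> \<Delta> \<and> left_gcd (complement \<Delta> s') s = 1 \<and>
      m' = left_gcd (complement \<Delta> s') (s * m)) w"

definition PSeq :: "'a::monoid_mult \<Rightarrow> nat \<Rightarrow> ('a \<times> 'a) list set"
  where "PSeq \<Delta> k = {w. is_penetration_sequence \<Delta> w \<and> length w = k}"

text \<open>Both limits exist in a Garside monoid: penetration sequences and normal forms are closed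
  under taking factors, so the two counting sequences are submultiplicative.\<close>

definition PSeq_growth_rate :: "'a::monoid_mult \<Rightarrow> real"
  where "PSeq_growth_rate \<Delta> = lim (\<lambda>k. root k (real (card (PSeq \<Delta> k))))"

definition sphere_growth_rate :: "'a::monoid_mult \<Rightarrow> real"
  where "sphere_growth_rate \<Delta> = lim (\<lambda>k. root k (real (card (length_sphere \<Delta> k))))"

end

theory Submission
  imports Defs
begin

text \<open>
  Let \<open>G\<^sub>k\<close> be the set of elements of infimum \<open>0\<close> and canonical length \<open>k\<close>. The expected value is
  bounded because a penetration distance of at least \<open>p\<close> is exponentially unlikely in \<open>p\<close>,
  uniformly in \<open>k\<close>.

  Let \<open>x = x\<^sub>1 \<cdots> x\<^sub>k\<close> be in normal form and \<open>a\<close> an atom. Multiplying by \<open>a\<close> on the right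
  changes the normal form from the right end inwards: the factor \<open>x\<^sub>k\<close> absorbs \<open>m\<^sub>1 = a\<close> if it can,
  the factor before it absorbs the part \<open>m\<^sub>2\<close> of \<open>x\<^sub>k a\<close> that it can, and so on. The process stops
  when nothing is absorbed (\<open>pd_le_if_normal\<close>) or when a factor is completed to \<open>\<Delta>\<close>
  (\<open>pd_le_if_Delta\<close>), and in both cases the factors to the left of that place are untouched. As
  long as it runs, the pairs (factor, part absorbed by it) form a penetration sequence. Hence, if
  the penetration distance is at least \<open>p > 0\<close>, the last \<open>p\<close> factors of \<open>x\<close> and the atom \<open>a\<close> can be
  read off from a penetration sequence of length \<open>p\<close> (\<open>penetration_sequence_exists\<close>), and there
  are at most \<open>\<bar>G\<^sub>k\<^sub>-\<^sub>p\<bar> \<sqdot> \<bar>PSeq\<^sub>p\<bar>\<close> such pairs \<open>(x, a)\<close> (\<open>card_pd_ge_le\<close>).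

  Choose \<open>\<alpha> < g' < g < \<beta>\<close>. Then \<open>\<bar>PSeq\<^sub>p\<bar> \<le> K g'\<^sup>p\<close> by the definition of \<open>\<alpha>\<close>. It remains to
  compare spheres of different radius: \<open>\<bar>G\<^sub>k\<^sub>-\<^sub>p\<bar> \<le> \<bar>G\<^sub>k\<bar> / (c g\<^sup>p)\<close> for some \<open>c > 0\<close> that depends
  neither on \<open>k\<close> nor on \<open>p\<close>. The growth rate alone does not give such a uniform estimate; it is a
  property of walks in finite directed graphs (\<open>card_walks_growth\<close>), and normal forms are such
  walks. The probability of a distance of at least \<open>p\<close> is then at most a constant times
  \<open>(g' / g)\<^sup>p\<close>, and summing over \<open>p\<close> bounds the expected value by a geometric series.

  For walks, call a vertex heavy if for some \<open>n\<close> more than \<open>g\<^sup>n\<close> loops of length \<open>n\<close> start there.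
  Decomposing a walk at the last visit to its first vertex shows that the walks avoiding all heavy
  vertices grow at a rate below \<open>\<beta>\<close> (\<open>card_walks_le_if_few_loops\<close>), so eventually at least half of
  all walks meet a heavy vertex. Such a walk is lengthened by inserting a loop at its first
  heavy vertex. Walk and loop can be recovered from the result, so inserting loops of length \<open>n\<close>
  multiplies the number of walks by at least a constant times \<open>g\<^sup>n\<close>
  (\<open>card_walks_insert_loops\<close>).
\<close>

section \<open>Submultiplicative sequences\<close>

text \<open>
  Cut \<open>n\<close> into blocks of length \<open>m\<close> and a remainder; the constant absorbs the finitely many
  remainders.
\<close>

lemma submultiplicative_exponential_bound:
  fixes a :: "nat \<Rightarrow> real"
  assumes sub: "\<And>m n. a (m + n) \<le> a m * a n" and nonneg: "\<And>n. 0 \<le> a n"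
    and m: "0 < m" and am: "a m \<le> c ^ m" and c: "0 < c"
  shows "\<exists>K>0. \<forall>n. a n \<le> K * c ^ n"
proof -
  have iter: "a (m * q + r) \<le> a m ^ q * a r" for q r
  proof (induction q)
    case (Suc q)
    have "a (m * Suc q + r) \<le> a m * a (m * q + r)"
      using sub[of m "m * q + r"] by (simp add: algebra_simps)
    also have "\<dots> \<le> a m * (a m ^ q * a r)"
      by (intro mult_left_mono Suc nonneg)
    finally show ?case by (simp add: mult.assoc)
  qed simp
  define K where "K = 1 + (\<Sum>r<m. a r / c ^ r)"
  have K: "K > 0"
    unfolding K_def using nonneg c by (intro add_pos_nonneg sum_nonneg divide_nonneg_pos) auto
  have "a n \<le> K * c ^ n" for n
  proof -
    define q r where "q = n div m" and "r = n mod m"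
    have n: "n = m * q + r" and r: "r < m"
      using m by (auto simp: q_def r_def)
    have "a r / c ^ r \<le> (\<Sum>r<m. a r / c ^ r)"
      by (rule member_le_sum) (use r nonneg c in auto)
    then have "a r / c ^ r \<le> K" by (simp add: K_def)
    then have ar: "a r \<le> K * c ^ r" using c by (simp add: field_simps)
    have "a n \<le> a m ^ q * a r"
      unfolding n by (rule iter)
    also have "\<dots> \<le> (c ^ m) ^ q * (K * c ^ r)"
      by (intro mult_mono power_mono am ar nonneg zero_le_power) (use c in auto)
    also have "\<dots> = K * c ^ n"
      by (simp add: n power_add power_mult)
    finally show ?thesis .
  qed
  with K show ?thesis by blast
qed

text \<open>
  Fekete's lemma in multiplicative form, with limit \<open>INF n\<ge>1. root n (a n)\<close>. That the limit is an
  infimum gives a lower bound for every single \<open>n\<close>, with no constant, and the preceding lemma gives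
  an upper bound for every larger rate.
\<close>

lemma submultiplicative_growth_rate:
  fixes a :: "nat \<Rightarrow> real"
  assumes sub: "\<And>m n. a (m + n) \<le> a m * a n" and nonneg: "\<And>n. 0 \<le> a n"
  obtains L where "(\<lambda>n. root n (a n)) \<longlonglongrightarrow> L" "0 \<le> L" "\<And>n. 0 < n \<Longrightarrow> L ^ n \<le> a n"
    "\<And>c. L < c \<Longrightarrow> \<exists>K>0. \<forall>n. a n \<le> K * c ^ n"
proof -
  define L where "L = (INF n\<in>{1..}. root n (a n))"
  have bdd: "bdd_below ((\<lambda>n. root n (a n)) ` {1..})"
    by (rule bdd_belowI2[of _ 0]) (simp add: nonneg)
  have L0: "0 \<le> L"
    unfolding L_def by (rule cINF_greatest) (auto simp: nonneg)
  have le: "L \<le> root n (a n)" if "0 < n" for n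
    unfolding L_def by (rule cINF_lower[OF bdd]) (use that in auto)
  have pow: "L ^ n \<le> a n" if "0 < n" for n
    using power_mono[OF le[OF that] L0, of n] that nonneg by simp
  have bound: "\<exists>K>0. \<forall>n. a n \<le> K * c ^ n" if c: "L < c" for c
  proof -
    obtain m where m: "1 \<le> m" "root m (a m) < c"
      using cINF_less_iff[OF _ bdd, of c] c unfolding L_def by auto
    have "a m = root m (a m) ^ m"
      using m nonneg by simp
    also have "\<dots> \<le> c ^ m"
      using m nonneg by (intro power_mono) auto
    finally show ?thesis
      using submultiplicative_exponential_bound[OF sub nonneg, of m c] m c L0 by simp
  qed
  have "(\<lambda>n. root n (a n)) \<longlonglongrightarrow> L"
  proof (rule order_tendstoI)
    fix b assume "b < L"
    then show "\<forall>\<^sub>F n in sequentially. b < root n (a n)"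
      by (intro eventually_sequentiallyI[of 1]) (use le in \<open>auto intro: less_le_trans\<close>)
  next
    fix b assume "L < b"
    then obtain c where c: "L < c" "c < b"
      using dense by blast
    obtain K where K: "K > 0" "\<And>n. a n \<le> K * c ^ n"
      using bound[OF c(1)] by blast
    have "(\<lambda>n. root n K * c) \<longlonglongrightarrow> 1 * c"
      by (intro tendsto_intros LIMSEQ_root_const K)
    then have "\<forall>\<^sub>F n in sequentially. root n K * c < b"
      by (rule order_tendstoD(2)) (use c in simp)
    then show "\<forall>\<^sub>F n in sequentially. root n (a n) < b"
      using eventually_gt_at_top[of "0::nat"]
    proof eventually_elim
      case (elim n)
      have "root n (a n) \<le> root n (K * c ^ n)"
        using elim K by (intro real_root_le_mono) auto
      also have "\<dots> = root n K * c"
        using elim c L0 by (simp add: real_root_mult real_root_power_cancel)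
      finally show ?case using elim by simp
    qed
  qed
  then show thesis
    using that L0 pow bound by blast
qed

section \<open>Walks in finite directed graphs\<close>

definition walks :: "'v set \<Rightarrow> ('v \<Rightarrow> 'v \<Rightarrow> bool) \<Rightarrow> nat \<Rightarrow> 'v list set"
  where "walks V R n = {xs. length xs = n \<and> set xs \<subseteq> V \<and> successively R xs}"

text \<open>
  A closed walk \<open>v = z\<^sub>1, \<dots>, z\<^sub>n, v\<close> is represented without its final \<open>v\<close>. In this way loops at \<open>v\<close>
  are composed by appending lists, they can be inserted in front of an occurrence of \<open>v\<close> in a
  walk, and there is exactly one loop of length \<open>0\<close>.
\<close>

definition loops :: "'v set \<Rightarrow> ('v \<Rightarrow> 'v \<Rightarrow> bool) \<Rightarrow> 'v \<Rightarrow> nat \<Rightarrow> 'v list set"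
  where "loops V R v n =
    {zs. length zs = n \<and> set zs \<subseteq> V \<and> successively R (zs @ [v]) \<and> (zs \<noteq> [] \<longrightarrow> hd zs = v)}"

lemma finite_walks: "finite V \<Longrightarrow> finite (walks V R n)"
  by (rule finite_subset[OF _ finite_lists_length_eq[of V n]]) (auto simp: walks_def)

lemma finite_loops: "finite V \<Longrightarrow> finite (loops V R v n)"
  by (rule finite_subset[OF _ finite_lists_length_eq[of V n]]) (auto simp: loops_def)

lemma walks_append:
  "us @ vs \<in> walks V R (length us + length vs) \<Longrightarrow>
    us \<in> walks V R (length us) \<and> vs \<in> walks V R (length vs)"
  by (auto simp: walks_def successively_append_iff)

lemma card_walks_add_le:
  assumes "finite V"
  shows "card (walks V R (m + n)) \<le> card (walks V R m) * card (walks V R n)"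
proof -
  have "walks V R (m + n) \<subseteq> (\<lambda>(us, vs). us @ vs) ` (walks V R m \<times> walks V R n)"
  proof
    fix xs assume xs: "xs \<in> walks V R (m + n)"
    then have len: "length xs = m + n" by (simp add: walks_def)
    have "take m xs \<in> walks V R m \<and> drop m xs \<in> walks V R n"
      using walks_append[of "take m xs" "drop m xs" V R] xs len by simp
    then show "xs \<in> (\<lambda>(us, vs). us @ vs) ` (walks V R m \<times> walks V R n)"
      by (intro image_eqI[of _ _ "(take m xs, drop m xs)"]) auto
  qed
  from surj_card_le[OF _ this] show ?thesis
    by (simp add: finite_walks assms card_cartesian_product)
qed

lemma card_loops_add_ge:
  assumes "finite V"
  shows "card (loops V R v m) * card (loops V R v n) \<le> card (loops V R v (m + n))"
proof -
  have "inj_on (\<lambda>(us, vs). us @ vs) (loops V R v m \<times> loops V R v n)"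
    by (auto simp: inj_on_def loops_def)
  moreover have "(\<lambda>(us, vs). us @ vs) ` (loops V R v m \<times> loops V R v n) \<subseteq> loops V R v (m + n)"
    by (auto simp: loops_def successively_append_iff hd_append last_append split: if_splits)
  ultimately show ?thesis
    using card_inj_on_le[OF _ _ finite_loops[OF assms]] by (metis card_cartesian_product)
qed

lemma card_loops_mult_ge:
  assumes "finite V"
  shows "card (loops V R v n) ^ j \<le> card (loops V R v (n * j))"
proof (induction j)
  case 0
  have "loops V R v 0 = {[]}" by (auto simp: loops_def)
  then show ?case by simp
next
  case (Suc j)
  have "card (loops V R v n) ^ Suc j \<le> card (loops V R v n) * card (loops V R v (n * j))"
    using Suc by simp
  also have "\<dots> \<le> card (loops V R v (n * Suc j))"
    using card_loops_add_ge[OF assms, of R v n "n * j"] by simp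
  finally show ?case .
qed

text \<open>
  Split at the last visit to the starting vertex \<open>v\<close>: what precedes it is a loop at \<open>v\<close>, and what
  follows avoids \<open>v\<close>, so that an induction on the vertex set can continue.
\<close>

lemma walks_last_visit_decomposition:
  "walks S R (Suc n) \<subseteq>
    (\<Union>v\<in>S. \<Union>j\<le>n. (\<lambda>(zs, us). zs @ v # us) ` (loops S R v j \<times> walks (S - {v}) R (n - j)))"
proof
  fix xs assume xs: "xs \<in> walks S R (Suc n)"
  then obtain v ys where v: "xs = v # ys" by (cases xs) (auto simp: walks_def)
  obtain zs us where split: "xs = zs @ v # us" "v \<notin> set us"
    using split_list_last[of v xs] v by auto
  have hd: "zs \<noteq> [] \<longrightarrow> hd zs = v"
    using split v by (cases zs) auto
  have len: "length zs \<le> n" "length us = n - length zs"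
    using xs split by (auto simp: walks_def)
  have "zs \<in> loops S R v (length zs)" "us \<in> walks (S - {v}) R (n - length zs)" "v \<in> S"
    using xs split hd len
    by (auto simp: loops_def walks_def successively_append_iff successively_Cons)
  then show "xs \<in> (\<Union>v\<in>S. \<Union>j\<le>n.
      (\<lambda>(zs, us). zs @ v # us) ` (loops S R v j \<times> walks (S - {v}) R (n - j)))"
    using len split by fastforce
qed

text \<open>
  Each step of the induction on the vertex set convolves a sequence of rate \<open>g\<close> with one of
  rate \<open>g'\<close>. Since \<open>g < g'\<close>, the convolution is dominated by a geometric series in \<open>g / g'\<close> and
  still has rate \<open>g'\<close>.
\<close>

lemma card_walks_le_if_few_loops:
  fixes g g' :: real
  assumes "finite S" and g: "0 < g" "g < g'"
    and few: "\<And>v n. v \<in> S \<Longrightarrow> real (card (loops S R v n)) \<le> g ^ n"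
  shows "\<exists>K\<ge>0. \<forall>n. real (card (walks S R n)) \<le> K * g' ^ n"
  using \<open>finite S\<close> few
proof (induction S rule: finite_psubset_induct)
  case (psubset S)
  note fin = psubset.hyps
  have "\<exists>K\<ge>0. \<forall>n. real (card (walks (S - {v}) R n)) \<le> K * g' ^ n" if v: "v \<in> S" for v
  proof (rule psubset.IH)
    show "S - {v} \<subset> S" using v by blast
    fix u n assume u: "u \<in> S - {v}"
    have "loops (S - {v}) R u n \<subseteq> loops S R u n" by (auto simp: loops_def)
    then have "card (loops (S - {v}) R u n) \<le> card (loops S R u n)"
      by (intro card_mono finite_loops fin)
    also have "real \<dots> \<le> g ^ n" using psubset.prems u by simp
    finally show "real (card (loops (S - {v}) R u n)) \<le> g ^ n" by simp
  qed
  then obtain K where K: "\<And>v. v \<in> S \<Longrightarrow> K v \<ge> 0"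
    "\<And>v n. v \<in> S \<Longrightarrow> real (card (walks (S - {v}) R n)) \<le> K v * g' ^ n"
    by metis
  define q where "q = g / g'"
  have q: "0 \<le> q" "q < 1" using g by (auto simp: q_def)
  define B where "B = 1 + (\<Sum>v\<in>S. K v / (1 - q)) / g'"
  have sumK: "0 \<le> (\<Sum>v\<in>S. K v / (1 - q))"
    using K q by (intro sum_nonneg) auto
  have B: "B \<ge> 1" using sumK g by (simp add: B_def)
  have step: "real (card (walks S R (Suc n))) \<le> B * g' ^ Suc n" for n
  proof -
    have geo: "(\<Sum>j\<le>n. q ^ j) \<le> 1 / (1 - q)"
    proof -
      have "(\<Sum>j\<le>n. q ^ j) \<le> (\<Sum>j. q ^ j)"
        by (rule sum_le_suminf) (use q in \<open>auto intro: summable_geometric\<close>)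
      then show ?thesis using q by (simp add: suminf_geometric)
    qed
    have "card (walks S R (Suc n)) \<le> card (\<Union>v\<in>S. \<Union>j\<le>n.
        (\<lambda>(zs, us). zs @ v # us) ` (loops S R v j \<times> walks (S - {v}) R (n - j)))"
      by (intro card_mono walks_last_visit_decomposition finite_UN_I finite_imageI
          finite_cartesian_product finite_loops finite_walks) (use fin in auto)
    also have "\<dots> \<le> (\<Sum>v\<in>S. card (\<Union>j\<le>n.
        (\<lambda>(zs, us). zs @ v # us) ` (loops S R v j \<times> walks (S - {v}) R (n - j))))"
      by (rule card_UN_le[OF fin])
    also have "\<dots> \<le> (\<Sum>v\<in>S. \<Sum>j\<le>n. card (loops S R v j \<times> walks (S - {v}) R (n - j)))"
      by (intro sum_mono order_trans[OF card_UN_le] card_image_le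
          finite_cartesian_product finite_loops finite_walks) (use fin in auto)
    finally have "real (card (walks S R (Suc n))) \<le>
        (\<Sum>v\<in>S. \<Sum>j\<le>n. real (card (loops S R v j)) * real (card (walks (S - {v}) R (n - j))))"
      unfolding card_cartesian_product of_nat_le_iff[symmetric, where ?'a = real] by simp
    also have "\<dots> \<le> (\<Sum>v\<in>S. \<Sum>j\<le>n. g ^ j * (K v * g' ^ (n - j)))"
      by (intro sum_mono mult_mono psubset.prems K) (use g in auto)
    also have "\<dots> = (\<Sum>v\<in>S. \<Sum>j\<le>n. K v * g' ^ n * q ^ j)"
    proof (intro sum.cong refl)
      fix v j assume "j \<in> {..n}"
      then have "g' ^ n = g' ^ (n - j) * g' ^ j"
        by (simp flip: power_add)
      then show "g ^ j * (K v * g' ^ (n - j)) = K v * g' ^ n * q ^ j"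
        using g by (simp add: q_def power_divide)
    qed
    also have "\<dots> = (\<Sum>v\<in>S. K v * g' ^ n * (\<Sum>j\<le>n. q ^ j))"
      by (simp add: sum_distrib_left)
    also have "\<dots> \<le> (\<Sum>v\<in>S. K v * g' ^ n * (1 / (1 - q)))"
      by (intro sum_mono mult_left_mono geo) (use K g in auto)
    also have "\<dots> = g' ^ n * (\<Sum>v\<in>S. K v / (1 - q))"
      by (simp add: sum_distrib_left mult_ac)
    also have "\<dots> \<le> B * g' ^ Suc n"
      using g by (simp add: B_def field_simps)
    finally show ?thesis .
  qed
  have "real (card (walks S R n)) \<le> B * g' ^ n" for n
  proof (cases n)
    case 0
    have "walks S R 0 = {[]}" by (auto simp: walks_def)
    then show ?thesis using B 0 by simp
  qed (use step in simp)
  then show ?case using B by (intro exI[of _ B]) auto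
qed

text \<open>
  Insert a loop immediately before the first visit to \<open>H\<close>. Since the loop itself starts in \<open>H\<close>, its
  starting point is again the first visit to \<open>H\<close> in the lengthened walk, and as its length \<open>n\<close> is
  known, the insertion can be undone.
\<close>

lemma card_walks_insert_loops:
  fixes c :: real
  assumes fin: "finite V" and H: "H \<subseteq> V"
    and many: "\<And>v. v \<in> H \<Longrightarrow> c \<le> real (card (loops V R v n))"
  shows "real (card (walks V R k - walks (V - H) R k)) * c \<le> real (card (walks V R (k + n)))"
proof -
  define W where "W = walks V R k - walks (V - H) R k"
  define pre where "pre xs = takeWhile (\<lambda>x. x \<notin> H) xs" for xs
  define suf where "suf xs = dropWhile (\<lambda>x. x \<notin> H) xs" for xs
  have suf: "suf xs \<noteq> [] \<and> hd (suf xs) \<in> H" if xs: "xs \<in> W" for xs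
  proof -
    have "\<exists>x\<in>set xs. x \<in> H"
      using xs by (auto simp: W_def walks_def)
    then have "suf xs \<noteq> []" by (auto simp: suf_def dropWhile_eq_Nil_conv)
    then show ?thesis using hd_dropWhile[of "\<lambda>x. x \<notin> H" xs] by (auto simp: suf_def)
  qed
  have split: "xs = pre xs @ suf xs" for xs by (simp add: pre_def suf_def)
  define L where "L xs = loops V R (hd (suf xs)) n" for xs
  define ins where "ins = (\<lambda>(xs, zs). pre xs @ zs @ suf xs)"
  have "inj_on ins (Sigma W L)"
  proof (rule inj_onI, clarify)
    fix xs zs ys ws
    assume xs: "xs \<in> W" and zs: "zs \<in> L xs" and ys: "ys \<in> W" and ws: "ws \<in> L ys"
      and eq: "ins (xs, zs) = ins (ys, ws)"
    have tw: "takeWhile (\<lambda>x. x \<notin> H) (ins (xs, zs)) = pre xs" if "xs \<in> W" "zs \<in> L xs" for xs zs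
    proof -
      have hdH: "hd (zs @ suf xs) \<in> H"
        using that suf[OF that(1)] by (cases zs) (auto simp: L_def loops_def)
      have ne: "zs @ suf xs \<noteq> []" using suf[OF that(1)] by simp
      have "takeWhile (\<lambda>x. x \<notin> H) (zs @ suf xs) = []"
        using hdH ne by (cases "zs @ suf xs") auto
      moreover have "takeWhile (\<lambda>x. x \<notin> H) (pre xs @ zs @ suf xs) =
          pre xs @ takeWhile (\<lambda>x. x \<notin> H) (zs @ suf xs)"
        by (rule takeWhile_append2) (auto simp: pre_def dest: set_takeWhileD)
      ultimately show ?thesis by (simp add: ins_def)
    qed
    have pre_eq: "pre xs = pre ys" using tw[OF xs zs] tw[OF ys ws] eq by simp
    then have "zs @ suf xs = ws @ suf ys" using eq by (simp add: ins_def)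
    moreover have "length zs = length ws" using zs ws by (simp add: L_def loops_def)
    ultimately have "zs = ws" "suf xs = suf ys" by auto
    then show "xs = ys \<and> zs = ws" using pre_eq split by metis
  qed
  moreover have "ins ` Sigma W L \<subseteq> walks V R (k + n)"
  proof clarify
    fix xs zs assume xs: "xs \<in> W" and zs: "zs \<in> L xs"
    have w: "pre xs @ suf xs \<in> walks V R k"
      using xs split by (metis DiffD1 W_def)
    obtain v vs where v: "suf xs = v # vs" using suf[OF xs] by (cases "suf xs") auto
    show "ins (xs, zs) \<in> walks V R (k + n)"
      using w zs unfolding ins_def
      by (cases "zs = []") (auto simp: v L_def loops_def walks_def successively_append_iff successively_Cons hd_append)
  qed
  ultimately have "card (Sigma W L) \<le> card (walks V R (k + n))"
    by (rule card_inj_on_le) (rule finite_walks[OF fin])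
  moreover have "card (Sigma W L) = (\<Sum>xs\<in>W. card (L xs))"
    by (rule card_SigmaI) (auto simp: W_def L_def finite_walks finite_loops fin)
  moreover have "real (card W) * c \<le> (\<Sum>xs\<in>W. real (card (L xs)))"
    using sum_bounded_below[of W c "\<lambda>xs. real (card (L xs))"] many suf by (auto simp: L_def)
  ultimately show ?thesis unfolding W_def by (simp flip: of_nat_sum)
qed

lemma walks_growth_rate:
  assumes "finite V"
  obtains L where "(\<lambda>n. root n (real (card (walks V R n)))) \<longlonglongrightarrow> L" "0 \<le> L"
    "\<And>n. L ^ n \<le> real (card (walks V R n))"
    "\<And>c. L < c \<Longrightarrow> \<exists>K>0. \<forall>n. real (card (walks V R n)) \<le> K * c ^ n"
proof -
  have "real (card (walks V R (m + n))) \<le> real (card (walks V R m)) * real (card (walks V R n))" for m n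
    using card_walks_add_le[OF assms, of R m n] by (simp flip: of_nat_mult)
  then obtain L where L: "(\<lambda>n. root n (real (card (walks V R n)))) \<longlonglongrightarrow> L" "0 \<le> L"
    "\<And>n. 0 < n \<Longrightarrow> L ^ n \<le> real (card (walks V R n))"
    "\<And>c. L < c \<Longrightarrow> \<exists>K>0. \<forall>n. real (card (walks V R n)) \<le> K * c ^ n"
    using submultiplicative_growth_rate[of "\<lambda>n. real (card (walks V R n))", OF _ of_nat_0_le_iff]
    by blast
  have "walks V R 0 = {[]}" by (auto simp: walks_def)
  then have "L ^ n \<le> real (card (walks V R n))" for n
    using L(3)[of n] by (cases "n = 0") auto
  then show thesis using that L by blast
qed

text \<open>
  Heavy vertices need not have loops of every length. But a single length \<open>N\<close> serves all of
  them at once, namely a common multiple of one good length for each, and the other lengths lie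
  within \<open>N\<close> of a multiple of \<open>N\<close>. The finitely many \<open>k\<close> for which the walks meeting heavy vertices
  need not be half of all walks are covered by the lower bound \<open>L\<^sup>n\<close>.
\<close>

lemma card_walks_growth:
  fixes g L :: real
  assumes fin: "finite V" and lower: "\<And>n. L ^ n \<le> real (card (walks V R n))"
    and g: "0 < g" "g < L"
  shows "\<exists>c>0. \<forall>k p. c * g ^ p * real (card (walks V R k)) \<le> real (card (walks V R (k + p)))"
proof -
  define w where "w n = real (card (walks V R n))" for n
  have w0: "0 \<le> w n" for n by (simp add: w_def)
  have w_add: "w (m + n) \<le> w m * w n" for m n
    unfolding w_def using card_walks_add_le[OF fin] by (simp flip: of_nat_mult)
  obtain g' where g': "g < g'" "g' < L" using g dense by blast
  define H where "H = {v \<in> V. \<exists>n. g ^ n < real (card (loops V R v n))}"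
  have H: "H \<subseteq> V" by (auto simp: H_def)
  then have finH: "finite H" using fin finite_subset by blast
  obtain K where K: "\<And>n. real (card (walks (V - H) R n)) \<le> K * g' ^ n"
  proof -
    have "real (card (loops (V - H) R v n)) \<le> g ^ n" if v: "v \<in> V - H" for v n
    proof -
      have "card (loops (V - H) R v n) \<le> card (loops V R v n)"
        by (intro card_mono finite_loops fin) (auto simp: loops_def)
      then have "real (card (loops (V - H) R v n)) \<le> real (card (loops V R v n))" by simp
      also have "\<dots> \<le> g ^ n" using v by (auto simp: H_def not_less)
      finally show ?thesis .
    qed
    then show thesis
      using card_walks_le_if_few_loops[of "V - H" g g' R] fin g g' that by auto
  qed
  have "(\<lambda>n. K * (g' / L) ^ n) \<longlonglongrightarrow> K * 0"
    by (intro tendsto_intros LIMSEQ_power_zero) (use g g' in auto)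
  then have "\<forall>\<^sub>F n in sequentially. K * (g' / L) ^ n < 1 / 2"
    by (rule order_tendstoD(2)) simp
  then obtain n0 where n0: "\<And>n. n0 \<le> n \<Longrightarrow> K * (g' / L) ^ n < 1 / 2"
    unfolding eventually_sequentially by blast
  have half: "w k / 2 \<le> real (card (walks V R k - walks (V - H) R k))" if k: "n0 \<le> k" for k
  proof -
    have "real (card (walks (V - H) R k)) \<le> K * (g' / L) ^ k * L ^ k"
      using K[of k] g g' by (simp add: power_divide)
    also have "\<dots> \<le> 1 / 2 * L ^ k"
      using n0[OF k] g g' by (intro mult_right_mono) auto
    also have "\<dots> \<le> w k / 2" using lower[of k] by (simp add: w_def)
    finally have "real (card (walks (V - H) R k)) \<le> w k / 2" .
    moreover have "card (walks V R k - walks (V - H) R k) =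
        card (walks V R k) - card (walks (V - H) R k)"
      by (intro card_Diff_subset finite_walks) (use fin in \<open>auto simp: walks_def\<close>)
    ultimately show ?thesis by (simp add: w_def)
  qed
  have "\<forall>v\<in>H. \<exists>n. g ^ n < real (card (loops V R v n))" by (simp add: H_def)
  then obtain n where n: "\<And>v. v \<in> H \<Longrightarrow> g ^ n v < real (card (loops V R v (n v)))"
    by metis
  define N where "N = (\<Prod>v\<in>H. n v)"
  have n_pos: "0 < n v" if "v \<in> H" for v
  proof (rule ccontr)
    assume "\<not> 0 < n v"
    moreover have "loops V R v 0 = {[]}" by (auto simp: loops_def)
    ultimately show False using n[OF that] by simp
  qed
  then have N: "0 < N" unfolding N_def by (intro prod_pos) auto
  have loops_ge: "g ^ (N * j) \<le> real (card (loops V R v (N * j)))" if v: "v \<in> H" for v j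
  proof -
    have "n v dvd N" unfolding N_def using v finH by (intro dvd_prodI)
    then obtain q where q: "N * j = n v * q" by (metis dvd_def mult.assoc)
    have "g ^ (N * j) = (g ^ n v) ^ q" by (simp add: q power_mult)
    also have "\<dots> \<le> real (card (loops V R v (n v))) ^ q"
      using n[OF v] g by (intro power_mono) auto
    also have "\<dots> \<le> real (card (loops V R v (N * j)))"
      using card_loops_mult_ge[OF fin, of R v "n v" q] by (simp add: q flip: of_nat_power)
    finally show ?thesis .
  qed
  define M where "M = 1 + (\<Sum>r\<le>N. w r)"
  have M: "1 \<le> M" using w0 by (simp add: M_def sum_nonneg)
  define c1 where "c1 = min 1 g ^ N / (2 * M)"
  have large: "c1 * g ^ p * w k \<le> w (k + p)" if k: "n0 \<le> k" for k p
  proof -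
    \<comment> \<open>Lengthen by the next multiple of \<open>N\<close> beyond \<open>p\<close>; dropping the surplus \<open>r\<close> costs at most
      the factor \<open>M\<close>.\<close>
    define j r where "j = Suc (p div N)" and "r = N * j - p"
    have Nj: "N * j = p + r" "r \<le> N"
      using less_imp_le[OF mod_less_divisor[OF N, of p]] mult_div_mod_eq[of N p]
    unfolding j_def r_def mult_Suc_right by linarith+
    have "min 1 g ^ N \<le> min 1 g ^ r"
      using Nj g by (intro power_decreasing) auto
    also have "\<dots> \<le> g ^ r" using g by (intro power_mono) auto
    finally have "min 1 g ^ N * g ^ p * w k \<le> g ^ (N * j) * w k"
      unfolding Nj power_add using w0 g by (simp add: mult.commute mult_left_mono mult_right_mono)
    also have "\<dots> \<le> 2 * (real (card (walks V R k - walks (V - H) R k)) * g ^ (N * j))"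
      using mult_left_mono[OF half[OF k], of "g ^ (N * j)"] g by (simp add: mult_ac)
    also have "\<dots> \<le> 2 * w (k + N * j)"
      unfolding w_def using card_walks_insert_loops[OF fin H loops_ge] by simp
    also have "w (k + N * j) \<le> w (k + p) * w r"
      using w_add[of "k + p" r] by (simp add: Nj add.assoc)
    also have "w r \<le> M"
      unfolding M_def using member_le_sum[of r "{..N}" w] w0 Nj by simp
    finally have "min 1 g ^ N * g ^ p * w k \<le> 2 * (w (k + p) * M)"
      using w0 by (simp add: mult_left_mono)
    then show ?thesis using M by (simp add: c1_def field_simps)
  qed
  define M0 where "M0 = 1 + (\<Sum>k<n0. w k)"
  have M0: "1 \<le> M0" using w0 by (simp add: M0_def sum_nonneg)
  define c2 where "c2 = min 1 L ^ n0 / M0"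
  have small: "c2 * g ^ p * w k \<le> w (k + p)" if k: "k < n0" for k p
  proof -
    have wk: "w k \<le> M0"
      unfolding M0_def using member_le_sum[of k "{..<n0}" w] w0 k by simp
    have "c2 * g ^ p * w k \<le> c2 * g ^ p * M0"
      using wk g M0 by (intro mult_left_mono) (auto simp: c2_def)
    also have "\<dots> = min 1 L ^ n0 * g ^ p" using M0 by (simp add: c2_def)
    also have "\<dots> \<le> L ^ k * L ^ p"
    proof (intro mult_mono power_mono)
      have "min 1 L ^ n0 \<le> min 1 L ^ k" using k g by (intro power_decreasing) auto
      also have "\<dots> \<le> L ^ k" using g by (intro power_mono) auto
      finally show "min 1 L ^ n0 \<le> L ^ k" .
    qed (use g in auto)
    also have "\<dots> \<le> w (k + p)" using lower[of "k + p"] by (simp add: w_def power_add)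
    finally show ?thesis .
  qed
  define c where "c = min c1 c2"
  have "0 < c" using g M M0 by (simp add: c_def c1_def c2_def)
  moreover have "c * g ^ p * w k \<le> w (k + p)" for k p
  proof -
    have "c * g ^ p * w k \<le> c1 * g ^ p * w k" "c * g ^ p * w k \<le> c2 * g ^ p * w k"
      unfolding c_def using g w0 by (auto intro!: mult_right_mono)
    then show ?thesis using large[of k p] small[of k p] by linarith
  qed
  ultimately show ?thesis unfolding w_def by blast
qed

section \<open>Divisibility and greatest common divisors\<close>

lemma ld_refl: "x \<preceq> x"
  unfolding left_divides_def by (metis mult_1_right)

lemma ld_trans: "x \<preceq> y \<Longrightarrow> y \<preceq> z \<Longrightarrow> x \<preceq> z"
  unfolding left_divides_def by (metis mult.assoc)

lemma ld_mult: "x \<preceq> x * c"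
  unfolding left_divides_def by blast

lemma one_ld: "1 \<preceq> x"
  unfolding left_divides_def by simp

lemma ld_mult_right: "x \<preceq> y \<Longrightarrow> x \<preceq> y * c"
  using ld_trans ld_mult by blast

lemma mult_ld_mono: "x \<preceq> y \<Longrightarrow> s * x \<preceq> s * y"
  unfolding left_divides_def by (metis mult.assoc)

lemma prod_list_takeWhile_eq: "prod_list (takeWhile (\<lambda>s. s = d) xs) = d ^ length (takeWhile (\<lambda>s. s = d) xs)"
  for d :: "'a::monoid_mult"
  by (induction xs) auto

lemma lattice_orderD:
  assumes "lattice_order le"
  shows "le x y \<Longrightarrow> le y x \<Longrightarrow> x = y"
    and "\<exists>m. le m x \<and> le m y \<and> (\<forall>z. le z x \<longrightarrow> le z y \<longrightarrow> le z m)"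
    and "\<exists>j. le x j \<and> le y j \<and> (\<forall>z. le x z \<longrightarrow> le y z \<longrightarrow> le j z)"
proof -
  obtain meet join where "class.lattice meet le (\<lambda>x y. le x y \<and> \<not> le y x) join"
    using assms unfolding lattice_order_def by blast
  then interpret lattice meet le "\<lambda>x y. le x y \<and> \<not> le y x" join .
  show "le x y \<Longrightarrow> le y x \<Longrightarrow> x = y" by (rule order.antisym)
  show "\<exists>m. le m x \<and> le m y \<and> (\<forall>z. le z x \<longrightarrow> le z y \<longrightarrow> le z m)"
    by (rule exI[of _ "meet x y"]) auto
  show "\<exists>j. le x j \<and> le y j \<and> (\<forall>z. le x z \<longrightarrow> le y z \<longrightarrow> le j z)"
    by (rule exI[of _ "join x y"]) auto
qed

context garside_monoid
begin

lemma ld_antisym: "x \<preceq> y \<Longrightarrow> y \<preceq> x \<Longrightarrow> x = (y :: 'a)"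
  by (rule lattice_orderD(1)[OF left_lattice])

lemma ld_one_iff: "x \<preceq> 1 \<longleftrightarrow> x = (1 :: 'a)"
  using ld_antisym one_ld by blast

lemma mult_eq_one: "a * b = 1 \<Longrightarrow> a = (1 :: 'a) \<and> b = 1"
  using ld_one_iff[of a] ld_mult[of a b] by auto

lemma mult_ld_mult_iff: "s * x \<preceq> s * y \<longleftrightarrow> x \<preceq> (y :: 'a)"
proof
  assume "s * x \<preceq> s * y"
  then obtain c where "s * (x * c) = s * y"
    unfolding left_divides_def by (auto simp: mult.assoc)
  then show "x \<preceq> y" using left_cancel left_divides_def by blast
qed (rule mult_ld_mono)

lemma left_gcd_eqI:
  assumes "d \<preceq> x" "d \<preceq> y" "\<And>e. e \<preceq> x \<Longrightarrow> e \<preceq> y \<Longrightarrow> e \<preceq> d"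
  shows "left_gcd x y = (d :: 'a)"
  unfolding left_gcd_def by (rule the_equality) (use assms in \<open>auto intro: ld_antisym\<close>)

lemma left_gcd_ld: "left_gcd x y \<preceq> (x :: 'a)" "left_gcd x y \<preceq> y"
  and ld_left_gcd: "e \<preceq> x \<Longrightarrow> e \<preceq> y \<Longrightarrow> e \<preceq> left_gcd x y"
proof -
  obtain d where d: "d \<preceq> x" "d \<preceq> y" "\<forall>e. e \<preceq> x \<longrightarrow> e \<preceq> y \<longrightarrow> e \<preceq> d"
    using lattice_orderD(2)[OF left_lattice, of x y] by blast
  then have "left_gcd x y = d" by (intro left_gcd_eqI) auto
  then show "left_gcd x y \<preceq> x" "left_gcd x y \<preceq> y" "e \<preceq> x \<Longrightarrow> e \<preceq> y \<Longrightarrow> e \<preceq> left_gcd x y"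
    using d by auto
qed

lemma left_gcd_absorb: "(x :: 'a) \<preceq> y \<Longrightarrow> left_gcd x y = x"
  by (rule left_gcd_eqI) (auto simp: ld_refl)

lemma left_gcd_commute: "left_gcd x y = left_gcd y (x :: 'a)"
  by (rule left_gcd_eqI) (auto intro: left_gcd_ld ld_left_gcd)

text \<open>
  The gcd of two left multiples of \<open>s\<close> is itself a left multiple of \<open>s\<close>, so \<open>s\<close> can be cancelled.
\<close>

lemma left_gcd_mult: "left_gcd (s * x) (s * y) = s * left_gcd x (y :: 'a)"
proof (rule left_gcd_eqI)
  fix e assume e: "e \<preceq> s * x" "e \<preceq> s * y"
  obtain d where d: "left_gcd (s * x) (s * y) = s * d"
    using ld_left_gcd[of s "s * x" "s * y"] ld_mult unfolding left_divides_def by metis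
  then have "d \<preceq> x" "d \<preceq> y"
    using left_gcd_ld[of "s * x" "s * y"] by (simp_all add: mult_ld_mult_iff)
  then have "s * d \<preceq> s * left_gcd x y" by (intro mult_ld_mono ld_left_gcd)
  moreover have "e \<preceq> s * d" using ld_left_gcd[OF e] d by simp
  ultimately show "e \<preceq> s * left_gcd x y" by (blast intro: ld_trans)
qed (auto simp: mult_ld_mult_iff left_gcd_ld)

lemma left_gcd_one_mono: "left_gcd s y = 1 \<Longrightarrow> x \<preceq> y \<Longrightarrow> left_gcd s x = (1 :: 'a)"
  by (metis ld_left_gcd ld_one_iff ld_trans left_gcd_ld)

section \<open>Simple elements and conjugation by \<open>\<Delta>\<close>\<close>

abbreviation D :: "'a set" where "D \<equiv> simple_elements \<Delta>"
abbreviation proper :: "'a set" where "proper \<equiv> proper_simple_elements \<Delta>"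
abbreviation compl :: "'a \<Rightarrow> 'a" where "compl \<equiv> complement \<Delta>"
abbreviation head :: "'a \<Rightarrow> 'a" where "head \<equiv> left_gcd \<Delta>"

lemma simple_iff_ld: "s \<in> D \<longleftrightarrow> s \<preceq> \<Delta>"
  by (simp add: simple_elements_def)

lemma simple_iff_rd: "s \<in> D \<longleftrightarrow> \<Delta> \<succeq> s"
  unfolding simple_left_right by simp

lemma simple_mult_left: "s * t \<in> D \<Longrightarrow> s \<in> D"
  using ld_mult ld_trans simple_iff_ld by blast

lemma simple_mult_right: "s * t \<in> D \<Longrightarrow> t \<in> D"
  unfolding simple_iff_rd right_divided_by_def by (metis mult.assoc)

lemma one_simple: "1 \<in> D" and Delta_simple: "\<Delta> \<in> D"
  by (simp_all add: simple_iff_ld one_ld ld_refl)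

lemma head_simple: "head x \<in> D"
  by (simp add: simple_iff_ld left_gcd_ld)

lemma mult_compl: "s \<in> D \<Longrightarrow> s * compl s = \<Delta>"
proof -
  assume "s \<in> D"
  then obtain t where "s * t = \<Delta>" by (auto simp: simple_iff_ld left_divides_def)
  then show ?thesis
    unfolding complement_def by (rule theI) (metis left_cancel \<open>s * t = \<Delta>\<close>)
qed

lemma compl_simple: "s \<in> D \<Longrightarrow> compl s \<in> D"
  using mult_compl simple_mult_right Delta_simple by metis

lemma compl_ld_Delta: "s \<in> D \<Longrightarrow> compl s \<preceq> \<Delta>"
  using compl_simple simple_iff_ld by blast

lemma compl_eq_one_iff: "s \<in> D \<Longrightarrow> compl s = 1 \<longleftrightarrow> s = \<Delta>"
  by (metis left_cancel mult_1_right mult_compl)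

lemma compl_eq_Delta_iff: "s \<in> D \<Longrightarrow> compl s = \<Delta> \<longleftrightarrow> s = 1"
  by (metis left_cancel mult_1_left mult_compl right_cancel)

lemma head_mult: "s \<in> D \<Longrightarrow> head (s * x) = s * left_gcd (compl s) x"
  using left_gcd_mult[of s "compl s" x] mult_compl by simp

lemma left_gcd_head: "s \<preceq> \<Delta> \<Longrightarrow> left_gcd s (head x) = left_gcd s x"
  by (rule left_gcd_eqI)
    (blast intro: left_gcd_ld ld_left_gcd ld_trans[OF left_gcd_ld(1)] ld_trans[OF _ left_gcd_ld(2)])+

text \<open>
  If \<open>s t = \<Delta> = t u\<close>, then \<open>s \<Delta> = s t u = \<Delta> u\<close>. The coincidence of left and right divisors of \<open>\<Delta>\<close>
  makes such \<open>t\<close> and \<open>u\<close> available for every simple \<open>s\<close>, and simple elements generate the monoid.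
\<close>

lemma Delta_commute:
  "\<exists>y. x * \<Delta> = \<Delta> * y" "\<exists>y. \<Delta> * x = y * \<Delta>"
proof -
  obtain xs where xs: "set xs \<subseteq> D" "prod_list xs = x"
    using simple_generate by blast
  have right: "\<exists>u. s * \<Delta> = \<Delta> * u" if s: "s \<in> D" for s
    using mult_compl[OF s] mult_compl[OF compl_simple[OF s]] by (metis mult.assoc)
  have left: "\<exists>u. \<Delta> * s = u * \<Delta>" if "s \<in> D" for s
  proof -
    obtain t where t: "\<Delta> = t * s" using \<open>s \<in> D\<close> by (auto simp: simple_iff_rd right_divided_by_def)
    then have "t \<in> D" using simple_mult_left Delta_simple by metis
    then obtain u where "\<Delta> = u * t" by (auto simp: simple_iff_rd right_divided_by_def)
    then show ?thesis using t by (metis mult.assoc)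
  qed
  show "\<exists>y. x * \<Delta> = \<Delta> * y" unfolding xs(2)[symmetric] using xs(1)
  proof (induction xs)
    case (Cons s xs)
    then have "s \<in> D" "\<exists>y. prod_list xs * \<Delta> = \<Delta> * y" by auto
    then obtain y u where "prod_list xs * \<Delta> = \<Delta> * y" "s * \<Delta> = \<Delta> * u"
      using right by blast
    then have "prod_list (s # xs) * \<Delta> = \<Delta> * (u * y)" by (metis mult.assoc prod_list.Cons)
    then show ?case ..
  qed (auto intro: exI[of _ 1])
  show "\<exists>y. \<Delta> * x = y * \<Delta>" unfolding xs(2)[symmetric] using xs(1)
  proof (induction xs)
    case (Cons s xs)
    then have "s \<in> D" "\<exists>y. \<Delta> * prod_list xs = y * \<Delta>" by auto
    then obtain y u where "\<Delta> * prod_list xs = y * \<Delta>" "\<Delta> * s = u * \<Delta>"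
      using left by blast
    then have "\<Delta> * prod_list (s # xs) = (u * y) * \<Delta>" by (metis mult.assoc prod_list.Cons)
    then show ?case ..
  qed (auto intro: exI[of _ 1])
qed

lemma Delta_power_commute:
  "\<exists>y. x * \<Delta> ^ n = \<Delta> ^ n * y" "\<exists>y. \<Delta> ^ n * x = y * \<Delta> ^ n"
proof -
  show "\<exists>y. x * \<Delta> ^ n = \<Delta> ^ n * y"
  proof (induction n arbitrary: x)
    case (Suc n)
    obtain y where y: "x * \<Delta> = \<Delta> * y" using Delta_commute by blast
    obtain z where "y * \<Delta> ^ n = \<Delta> ^ n * z" using Suc by blast
    then have "x * \<Delta> ^ Suc n = \<Delta> ^ Suc n * z" using y by (metis mult.assoc power_Suc)
    then show ?case ..
  qed simp
  show "\<exists>y. \<Delta> ^ n * x = y * \<Delta> ^ n"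
  proof (induction n arbitrary: x)
    case (Suc n)
    obtain y where y: "\<Delta> ^ n * x = y * \<Delta> ^ n" using Suc by blast
    obtain z where "\<Delta> * y = z * \<Delta>" using Delta_commute by blast
    then have "\<Delta> ^ Suc n * x = z * \<Delta> ^ Suc n" using y by (metis mult.assoc power_Suc)
    then show ?case ..
  qed simp
qed

section \<open>Normal forms\<close>

lemma prod_simples_ld: "set ts \<subseteq> D \<Longrightarrow> prod_list ts \<preceq> \<Delta> ^ length ts"
proof (induction ts)
  case (Cons t ts)
  obtain y where y: "compl t * \<Delta> ^ length ts = \<Delta> ^ length ts * y"
    using Delta_power_commute by blast
  have "t * \<Delta> ^ length ts * y = t * compl t * \<Delta> ^ length ts"
    by (simp only: mult.assoc y)
  also have "\<dots> = \<Delta> ^ length (t # ts)"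
    using Cons.prems by (simp add: mult_compl)
  finally have "t * \<Delta> ^ length ts * y = \<Delta> ^ length (t # ts)" .
  then have "t * \<Delta> ^ length ts \<preceq> \<Delta> ^ length (t # ts)"
    unfolding left_divides_def by blast
  then show ?case
    using Cons mult_ld_mono[of "prod_list ts" "\<Delta> ^ length ts" t] by (auto intro: ld_trans)
qed (simp add: ld_refl)

text \<open>
  A simple factor is split off on the right. If \<open>d c = \<Delta>\<^sup>n\<^sup>+\<^sup>1\<close>, let \<open>l = t c\<close> be the least common
  left multiple of \<open>c\<close> and \<open>\<Delta>\<close>. It is a right divisor of \<open>\<Delta> c\<close>, which is a common left
  multiple since \<open>\<Delta> c = y \<Delta>\<close> for some \<open>y\<close>; hence \<open>t\<close> is simple. It is also a right divisor of \<open>\<Delta>\<^sup>n\<^sup>+\<^sup>1 = g l\<close>,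
  hence \<open>d = g t\<close>, and \<open>g\<close> is a left divisor of \<open>\<Delta>\<^sup>n\<close> because \<open>l\<close> is a left multiple of \<open>\<Delta>\<close>.
\<close>

lemma Delta_power_divisor_factors:
  "d \<preceq> \<Delta> ^ n \<Longrightarrow> \<exists>ts. set ts \<subseteq> D \<and> length ts = n \<and> prod_list ts = d"
proof (induction n arbitrary: d)
  case 0
  then show ?case by (simp add: ld_one_iff)
next
  case (Suc n)
  then obtain c where c: "d * c = \<Delta> ^ Suc n" unfolding left_divides_def by blast
  obtain l where l: "l \<succeq> c" "l \<succeq> \<Delta>" "\<And>z. z \<succeq> c \<Longrightarrow> z \<succeq> \<Delta> \<Longrightarrow> z \<succeq> l"
    using lattice_orderD(3)[OF right_lattice, of c \<Delta>] by blast
  obtain t where t: "l = t * c" using l(1) unfolding right_divided_by_def by blast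
  obtain t' where t': "l = t' * \<Delta>" using l(2) unfolding right_divided_by_def by blast
  have "\<Delta> * c \<succeq> l"
    using Delta_commute(2)[of c] by (intro l) (auto simp: right_divided_by_def)
  then obtain u where "\<Delta> * c = u * (t * c)" unfolding right_divided_by_def t by blast
  then have "\<Delta> = u * t" using right_cancel by (metis mult.assoc)
  then have tD: "t \<in> D" unfolding simple_iff_rd right_divided_by_def by blast
  have "\<Delta> ^ Suc n \<succeq> l"
    using c by (intro l) (auto simp: right_divided_by_def power_Suc2 simp del: power_Suc intro: sym)
  then obtain g where g: "\<Delta> ^ Suc n = g * l" unfolding right_divided_by_def by blast
  have d: "d = g * t"
    using g c unfolding t by (metis mult.assoc right_cancel)
  have "\<Delta> ^ n * \<Delta> = (g * t') * \<Delta>"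
    using g unfolding t' by (simp add: power_Suc2 mult.assoc del: power_Suc)
  then have "\<Delta> ^ n = g * t'" by (rule right_cancel)
  then have "g \<preceq> \<Delta> ^ n" unfolding left_divides_def by metis
  then obtain ts where "set ts \<subseteq> D" "length ts = n" "prod_list ts = g" using Suc.IH by blast
  then show ?case using tD d by (intro exI[of _ "ts @ [t]"]) auto
qed

text \<open>
  Extracting the greatest simple left divisor does not increase the number of simple factors:
  each factor \<open>t\<close> takes a left divisor \<open>m\<close> of the head \<open>m h\<close> of what follows it, and the rest \<open>h\<close>
  of that head is again simple.
\<close>

lemma head_split:
  assumes "set (t # ts) \<subseteq> D"
  shows "\<exists>us. set us \<subseteq> D \<and> length us = length ts \<and>
    prod_list (t # ts) = head (prod_list (t # ts)) * prod_list us"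
  using assms
proof (induction ts arbitrary: t)
  case Nil
  then show ?case
    by (simp add: left_gcd_commute[of \<Delta>] left_gcd_absorb simple_iff_ld)
next
  case (Cons s ts)
  define y where "y = prod_list (s # ts)"
  obtain us where us: "set us \<subseteq> D" "length us = length ts" "y = head y * prod_list us"
    using Cons.IH[of s] Cons.prems unfolding y_def by auto
  have t: "t \<in> D" using Cons.prems by simp
  define m where "m = left_gcd (compl t) y"
  have "m \<preceq> head y"
    unfolding m_def by (intro ld_left_gcd left_gcd_ld) (metis compl_ld_Delta ld_trans left_gcd_ld(1) t)
  then obtain h where h: "head y = m * h" unfolding left_divides_def by metis
  have "h \<in> D" using simple_mult_right head_simple h by metis
  moreover have "t * y = head (t * y) * prod_list (h # us)"
  proof -
    have "t * y = t * (m * h * prod_list us)" using us(3) h by simp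
    also have "\<dots> = head (t * y) * prod_list (h # us)"
      by (simp add: head_mult[OF t] mult.assoc flip: m_def)
    finally show ?thesis .
  qed
  ultimately show ?case
    using us unfolding y_def by (intro exI[of _ "h # us"]) auto
qed

lemma tail_ld_Delta_power:
  assumes "d \<preceq> \<Delta> ^ Suc n" "d = head d * e"
  shows "e \<preceq> \<Delta> ^ n"
proof -
  obtain ts where ts: "set ts \<subseteq> D" "length ts = Suc n" "prod_list ts = d"
    using Delta_power_divisor_factors assms(1) by blast
  then obtain t ts' where t: "ts = t # ts'" by (cases ts) auto
  obtain us where us: "set us \<subseteq> D" "length us = n" "d = head d * prod_list us"
    using head_split[of t ts'] ts unfolding t by auto
  then have "e = prod_list us" using assms(2) left_cancel by metis
  then show ?thesis using prod_simples_ld us by blast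
qed

abbreviation normal_pair :: "'a \<Rightarrow> 'a \<Rightarrow> bool" where "normal_pair \<equiv> \<lambda>s t. left_gcd (compl s) t = 1"

text \<open>
  The normality conditions concern neighbouring factors only. By induction \<open>x'\<close> is the head of all
  that follows \<open>x\<close>, and what the simple element \<open>complement \<Delta> x\<close> has in common with a product it has in common
  with the head of the product.
\<close>

lemma head_normal_prod:
  assumes "set (x # xs) \<subseteq> D" "successively normal_pair (x # xs)" "normal_pair (last (x # xs)) y"
  shows "head (prod_list (x # xs) * y) = x"
  using assms
proof (induction xs arbitrary: x)
  case Nil
  then show ?case by (simp add: head_mult)
next
  case (Cons x' xs)
  define z where "z = prod_list (x' # xs) * y"
  have x: "x \<in> D" "normal_pair x x'" using Cons.prems(1,2) by auto
  have "head z = x'"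
    unfolding z_def using Cons.prems by (intro Cons.IH) auto
  then have "left_gcd (compl x) z = 1"
    using left_gcd_head[OF compl_ld_Delta[OF x(1)], of z] x(2) by simp
  then show ?case using head_mult[OF x(1), of z] by (simp add: z_def mult.assoc)
qed

text \<open>
  The gcd with \<open>\<Delta>\<^sup>n\<close> reads off the first \<open>n\<close> factors of a normal form. The definition of the
  penetration distance uses these gcds, so this is its link to normal forms.
\<close>

lemma Delta_power_gcd_normal_prod:
  assumes "set xs \<subseteq> D" "successively normal_pair xs" "xs \<noteq> [] \<Longrightarrow> normal_pair (last xs) y"
  shows "left_gcd (prod_list xs * y) (\<Delta> ^ length xs) = prod_list xs"
  using assms
proof (induction xs)
  case Nil
  then show ?case by (simp add: left_gcd_commute[of y] left_gcd_absorb one_ld)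
next
  case (Cons x xs)
  define z where "z = prod_list xs * y"
  define d where "d = left_gcd (x * z) (\<Delta> ^ Suc (length xs))"
  have IH: "left_gcd z (\<Delta> ^ length xs) = prod_list xs"
    unfolding z_def using Cons.prems by (intro Cons.IH) (auto simp: successively_Cons)
  have head: "head (x * z) = x"
    using head_normal_prod[of x xs y] Cons.prems by (simp add: z_def mult.assoc)
  have xD: "x \<preceq> \<Delta>" using Cons.prems by (simp add: simple_iff_ld)
  have "x \<preceq> d"
    unfolding d_def using xD by (intro ld_left_gcd ld_mult) (simp add: ld_mult_right)
  have "head d = x"
  proof (rule left_gcd_eqI[OF xD \<open>x \<preceq> d\<close>])
    fix e assume "e \<preceq> \<Delta>" "e \<preceq> d"
    then have "e \<preceq> head (x * z)"
      unfolding d_def by (blast intro: ld_left_gcd ld_trans[OF _ left_gcd_ld(1)])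
    then show "e \<preceq> x" by (simp only: head)
  qed
  obtain e where e: "d = x * e" using \<open>x \<preceq> d\<close> unfolding left_divides_def by metis
  have "e \<preceq> \<Delta> ^ length xs"
  proof (rule tail_ld_Delta_power)
    show "d \<preceq> \<Delta> ^ Suc (length xs)" unfolding d_def by (rule left_gcd_ld)
    show "d = head d * e" unfolding \<open>head d = x\<close> by (rule e)
  qed
  moreover have "e \<preceq> z"
    using left_gcd_ld(1)[of "x * z"] e mult_ld_mult_iff unfolding d_def by metis
  ultimately have "e \<preceq> prod_list xs" using IH ld_left_gcd by metis
  then have "d \<preceq> prod_list (x # xs)" unfolding e by (simp add: mult_ld_mult_iff)
  moreover have "prod_list (x # xs) \<preceq> d"
    unfolding d_def using prod_simples_ld[of "x # xs"] Cons.prems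
    by (intro ld_left_gcd) (auto simp: z_def ld_mult mult_ld_mult_iff)
  ultimately show ?case unfolding d_def z_def by (auto intro: ld_antisym simp: mult.assoc)
qed

text \<open>
  Taking heads repeatedly terminates, as each head uses up one of the given simple factors.
\<close>

lemma normal_form_exists:
  "set ts \<subseteq> D \<Longrightarrow> \<exists>xs. is_normal_form \<Delta> xs \<and> prod_list xs = prod_list ts"
proof (induction "length ts" arbitrary: ts)
  case 0
  then show ?case by (intro exI[of _ "[]"]) (simp add: is_normal_form_def)
next
  case (Suc n)
  then obtain t ts' where ts: "ts = t # ts'" by (cases ts) auto
  define h where "h = head (prod_list ts)"
  obtain us where us: "set us \<subseteq> D" "length us = n" "prod_list ts = h * prod_list us"
    using head_split[of t ts'] Suc ts unfolding h_def by auto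
  obtain xs where xs: "is_normal_form \<Delta> xs" "prod_list xs = prod_list us"
    using Suc.hyps(1)[of us] us by auto
  show ?case
  proof (cases "h = 1")
    case True
    then show ?thesis using xs us by auto
  next
    case False
    have hD: "h \<in> D" unfolding h_def by (rule head_simple)
    have "h * left_gcd (compl h) (prod_list us) = head (h * prod_list us)"
      by (simp only: head_mult[OF hD])
    also have "\<dots> = h * 1"
      by (simp only: us(3)[symmetric] h_def[symmetric] mult_1_right)
    finally have "left_gcd (compl h) (prod_list us) = 1" by (rule left_cancel)
    moreover have "hd xs \<preceq> prod_list us" if "xs \<noteq> []"
      unfolding xs(2)[symmetric] using that by (cases xs) (simp_all add: ld_mult)
    ultimately have "xs \<noteq> [] \<Longrightarrow> normal_pair h (hd xs)"
      using left_gcd_one_mono by blast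
    then have "is_normal_form \<Delta> (h # xs)"
      using xs(1) hD False by (auto simp: is_normal_form_def successively_Cons)
    then show ?thesis using us xs by (intro exI[of _ "h # xs"]) auto
  qed
qed

lemma left_gcd_one_right: "left_gcd x 1 = (1 :: 'a)"
  by (simp add: left_gcd_eqI one_ld)

lemma head_normal_form:
  "is_normal_form \<Delta> (x # xs) \<Longrightarrow> head (prod_list (x # xs)) = x"
  using head_normal_prod[of x xs 1] by (simp add: is_normal_form_def left_gcd_one_right subset_Diff_insert)

lemma normal_form_unique:
  "is_normal_form \<Delta> xs \<Longrightarrow> is_normal_form \<Delta> ys \<Longrightarrow> prod_list xs = prod_list ys \<Longrightarrow> xs = ys"
proof (induction xs arbitrary: ys)
  case Nil
  show ?case
  proof (cases ys)
    case (Cons y ys')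
    then have "y = 1" using Nil mult_eq_one[of y "prod_list ys'"] by simp
    then show ?thesis using Nil Cons by (simp add: is_normal_form_def)
  qed simp
next
  case (Cons x xs)
  show ?case
  proof (cases ys)
    case Nil
    then have "x = 1" using Cons mult_eq_one[of x "prod_list xs"] by simp
    then show ?thesis using Cons by (simp add: is_normal_form_def)
  next
    case ys: (Cons y ys')
    have "x = y"
      using head_normal_form Cons.prems ys by metis
    moreover have "prod_list xs = prod_list ys'"
      using Cons.prems(3) left_cancel unfolding ys \<open>x = y\<close> by simp
    moreover have "is_normal_form \<Delta> xs" "is_normal_form \<Delta> ys'"
      using Cons.prems ys by (auto simp: is_normal_form_def successively_Cons)
    ultimately show ?thesis using Cons.IH ys by blast
  qed
qed

lemma normal_form_eq: "is_normal_form \<Delta> xs \<Longrightarrow> normal_form \<Delta> (prod_list xs) = xs"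
  unfolding normal_form_def by (rule the_equality) (auto intro: normal_form_unique)

lemma is_normal_form_normal_form: "is_normal_form \<Delta> (normal_form \<Delta> x)"
  and prod_normal_form: "prod_list (normal_form \<Delta> x) = x"
proof -
  obtain ts where "set ts \<subseteq> D" "prod_list ts = x" using simple_generate by blast
  then obtain xs where xs: "is_normal_form \<Delta> xs" "prod_list xs = x"
    using normal_form_exists by blast
  then have "normal_form \<Delta> x = xs" using normal_form_eq by blast
  then show "is_normal_form \<Delta> (normal_form \<Delta> x)" "prod_list (normal_form \<Delta> x) = x"
    using xs by auto
qed

text \<open>
  If \<open>x \<noteq> \<Delta>\<close> then the complement of \<open>x\<close> is not \<open>1\<close> and divides \<open>\<Delta>\<close>, so \<open>\<Delta>\<close> cannot follow \<open>x\<close>.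
\<close>

lemma normal_form_nonDelta:
  "is_normal_form \<Delta> (x # xs) \<Longrightarrow> x \<noteq> \<Delta> \<Longrightarrow> \<Delta> \<notin> set (x # xs)"
proof (induction xs arbitrary: x)
  case (Cons x' xs)
  have x: "x \<in> D" "normal_pair x x'" using Cons.prems by (auto simp: is_normal_form_def)
  have "x' \<noteq> \<Delta>"
    using x Cons.prems(2) left_gcd_absorb[OF compl_ld_Delta[of x]] compl_eq_one_iff by auto
  moreover have "is_normal_form \<Delta> (x' # xs)" using Cons.prems by (simp add: is_normal_form_def)
  ultimately show ?case using Cons by auto
qed simp

section \<open>Infimum, canonical length and spheres\<close>

lemma infimum_eq_0: "\<not> \<Delta> \<preceq> x \<Longrightarrow> infimum \<Delta> x = 0"
  using prod_normal_form[of x] ld_mult[of \<Delta>]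
  by (cases "normal_form \<Delta> x") (auto simp: infimum_def)

lemma infimum_pos:
  assumes "\<Delta> \<preceq> x" "\<Delta> \<noteq> 1"
  shows "0 < infimum \<Delta> x"
proof (cases "normal_form \<Delta> x")
  case Nil
  then have "x = 1" using prod_normal_form[of x] by simp
  then show ?thesis using assms by (simp add: ld_one_iff)
next
  case (Cons h t)
  then have "h = head x"
    using head_normal_form[of h t] is_normal_form_normal_form[of x] prod_normal_form[of x] by simp
  also have "\<dots> = \<Delta>" using assms by (simp add: left_gcd_absorb)
  finally show ?thesis using Cons by (simp add: infimum_def)
qed

lemma remove_Delta_mult: "remove_Delta \<Delta> x * \<Delta> ^ infimum \<Delta> x = x"
proof -
  let ?l = "normal_form \<Delta> x"
  have "x = prod_list (takeWhile (\<lambda>s. s = \<Delta>) ?l @ dropWhile (\<lambda>s. s = \<Delta>) ?l)"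
    by (simp only: takeWhile_dropWhile_id prod_normal_form)
  then have "x = \<Delta> ^ infimum \<Delta> x * prod_list (dropWhile (\<lambda>s. s = \<Delta>) ?l)"
    by (simp only: prod_list.append prod_list_takeWhile_eq infimum_def)
  then obtain z where z: "z * \<Delta> ^ infimum \<Delta> x = x"
    using Delta_power_commute(2) by metis
  show ?thesis
    unfolding remove_Delta_def by (rule theI, rule z) (metis z right_cancel)
qed

lemma remove_Delta_eq_self: "infimum \<Delta> x = 0 \<Longrightarrow> remove_Delta \<Delta> x = x"
  using remove_Delta_mult[of x] by simp

lemma proper_simpleD: "s \<in> proper \<Longrightarrow> s \<in> D \<and> s \<noteq> 1 \<and> s \<noteq> \<Delta>"
  by (simp add: proper_simple_elements_def)

lemma finite_proper_simple: "finite proper"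
  unfolding proper_simple_elements_def using finite_simple by simp

lemma walk_is_normal_form: "xs \<in> walks proper normal_pair k \<Longrightarrow> is_normal_form \<Delta> xs"
  by (auto simp: walks_def is_normal_form_def dest: proper_simpleD)

lemma inf_cl_walk:
  assumes "xs \<in> walks proper normal_pair k"
  shows "infimum \<Delta> (prod_list xs) = 0" "canonical_length \<Delta> (prod_list xs) = k"
proof -
  have nf: "normal_form \<Delta> (prod_list xs) = xs"
    by (rule normal_form_eq[OF walk_is_normal_form[OF assms]])
  have "xs = [] \<or> hd xs \<noteq> \<Delta>"
    using assms proper_simpleD by (cases xs) (auto simp: walks_def)
  then show "infimum \<Delta> (prod_list xs) = 0" "canonical_length \<Delta> (prod_list xs) = k"
    unfolding infimum_def canonical_length_def nf
    using assms by (cases xs; auto simp: walks_def)+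
qed

text \<open>
  This turns the counting of spheres into the counting of walks in the finite graph of proper simple elements.
\<close>

lemma length_sphere_eq: "length_sphere \<Delta> k = prod_list ` walks proper normal_pair k"
proof
  show "prod_list ` walks proper normal_pair k \<subseteq> length_sphere \<Delta> k"
    using inf_cl_walk by (auto simp: length_sphere_def)
  show "length_sphere \<Delta> k \<subseteq> prod_list ` walks proper normal_pair k"
  proof
    fix x assume x: "x \<in> length_sphere \<Delta> k"
    define xs where "xs = normal_form \<Delta> x"
    have xs: "is_normal_form \<Delta> xs" "prod_list xs = x"
      unfolding xs_def by (rule is_normal_form_normal_form prod_normal_form)+
    have "xs = [] \<or> hd xs \<noteq> \<Delta>"
      using x by (cases xs) (auto simp: length_sphere_def infimum_def simp flip: xs_def split: if_splits)
    then have "\<Delta> \<notin> set xs" "dropWhile (\<lambda>s. s = \<Delta>) xs = xs"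
      using normal_form_nonDelta[of "hd xs" "tl xs"] xs(1) by (cases xs; simp)+
    then have "xs \<in> walks proper normal_pair k"
      using xs(1) x by (auto simp: walks_def is_normal_form_def length_sphere_def
          canonical_length_def proper_simple_elements_def simp flip: xs_def)
    then show "x \<in> prod_list ` walks proper normal_pair k" using xs(2) by blast
  qed
qed

lemma card_length_sphere: "card (length_sphere \<Delta> k) = card (walks proper normal_pair k)"
  unfolding length_sphere_eq
  by (intro card_image inj_onI) (blast intro: normal_form_unique walk_is_normal_form)

lemma finite_length_sphere: "finite (length_sphere \<Delta> k)"
  unfolding length_sphere_eq by (intro finite_imageI finite_walks finite_proper_simple)

section \<open>Atoms\<close>

lemma atoms_subset_simple: "atoms \<subseteq> D"
proof
  fix a :: 'a assume a: "a \<in> atoms"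
  have "prod_list xs \<in> atoms \<Longrightarrow> set xs \<subseteq> D \<Longrightarrow> prod_list xs \<in> D" for xs
  proof (induction xs)
    case (Cons s xs)
    then have "s = 1 \<or> prod_list xs = 1" by (auto simp: atoms_def)
    then show ?case using Cons by auto
  qed (simp add: one_simple)
  then show "a \<in> D" using simple_generate[of a] a by auto
qed

text \<open>
  Without atoms every nontrivial element would have a nontrivial proper left divisor, and
  iterating this would give an infinite descending chain.
\<close>

lemma atoms_nonempty:
  assumes "s \<noteq> (1 :: 'a)"
  shows "(atoms :: 'a set) \<noteq> {}"
proof
  assume "(atoms :: 'a set) = {}"
  then have step: "\<exists>a. a \<noteq> 1 \<and> a \<preceq> x \<and> a \<noteq> x" if "x \<noteq> 1" for x :: 'a
  proof -
    obtain a b where ab: "x = a * b" "a \<noteq> 1" "b \<noteq> 1"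
    proof -
      have "x \<notin> atoms" using \<open>atoms = {}\<close> by simp
      then show thesis using \<open>x \<noteq> 1\<close> that by (auto simp: atoms_def)
    qed
    have "a \<noteq> x" using ab(1,3) left_cancel[of a b 1] by auto
    then show ?thesis using ab ld_mult by blast
  qed
  have "\<exists>f :: nat \<Rightarrow> 'a. \<forall>n. f n \<noteq> 1 \<and> (f (Suc n) \<preceq> f n \<and> f (Suc n) \<noteq> f n)"
    by (rule dependent_nat_choice) (use assms step in blast)+
  then show False using left_noetherian by blast
qed

section \<open>How multiplication by an atom penetrates a normal form\<close>

lemma gcd_compl_normal_prod:
  assumes "us @ vs \<in> walks proper normal_pair k" "us \<noteq> []"
  shows "normal_pair (last us) (prod_list vs)"
proof (cases vs)
  case Nil
  then show ?thesis by (simp add: left_gcd_one_right)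
next
  case (Cons v vs')
  have w: "vs \<in> walks proper normal_pair (length vs)" "us \<in> walks proper normal_pair (length us)"
    using assms walks_append[of us vs proper normal_pair] by (auto simp: walks_def)
  have "last us \<in> D"
    using w(2) last_in_set[OF assms(2)] proper_simpleD unfolding walks_def by blast
  moreover have "head (prod_list vs) = v"
    using head_normal_form[of v vs'] walk_is_normal_form[OF w(1)] unfolding Cons by simp
  moreover have "normal_pair (last us) v"
    using assms Cons by (auto simp: walks_def successively_append_iff)
  ultimately show ?thesis
    using left_gcd_head[OF compl_ld_Delta, of "last us" "prod_list vs"] by simp
qed

lemma Delta_power_gcd_walk:
  assumes "us @ vs \<in> walks proper normal_pair k"
  shows "left_gcd (prod_list (us @ vs)) (\<Delta> ^ length us) = prod_list us"
  using Delta_power_gcd_normal_prod[of us "prod_list vs"] gcd_compl_normal_prod[OF assms] assms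
  by (auto simp: walks_def successively_append_iff dest: proper_simpleD)

text \<open>
  The hypothesis says that the first \<open>length us\<close> factors survive the multiplication by \<open>a\<close>.
\<close>

lemma pd_le_if_prefix_stable:
  assumes w: "us @ vs \<in> walks proper normal_pair k"
    and stable: "left_gcd (remove_Delta \<Delta> (prod_list (us @ vs) * a)) (\<Delta> ^ length us) = prod_list us"
  shows "pd \<Delta> (prod_list (us @ vs)) a \<le> length vs"
proof -
  let ?x = "prod_list (us @ vs)"
  let ?S = "{i \<in> {0..canonical_length \<Delta> ?x}.
      left_gcd (remove_Delta \<Delta> ?x) (\<Delta> ^ i) = left_gcd (remove_Delta \<Delta> (?x * a)) (\<Delta> ^ i)}"
  have cl: "canonical_length \<Delta> ?x = length us + length vs"
    using inf_cl_walk(2)[OF w] w by (simp add: walks_def)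
  have "length us \<in> ?S"
    using Delta_power_gcd_walk[OF w] remove_Delta_eq_self[OF inf_cl_walk(1)[OF w]] stable
    by (simp only: cl) simp
  then have "length us \<le> Max ?S" by (intro Max_ge) auto
  then show ?thesis unfolding pd_def cl by simp
qed

text \<open>
  If \<open>last us\<close> can absorb nothing from what follows it, then the normal form of the product
  starts with \<open>us\<close>. In particular it does not start with \<open>\<Delta>\<close>, and no power of \<open>\<Delta>\<close> is removed.
\<close>

lemma pd_le_if_normal:
  assumes w: "us @ vs \<in> walks proper normal_pair k" and us: "us \<noteq> []" and normal_pair: "normal_pair (last us) (prod_list vs * a)"
  shows "pd \<Delta> (prod_list (us @ vs)) a \<le> length vs"
proof (rule pd_le_if_prefix_stable[OF w])
  let ?y = "prod_list (us @ vs) * a"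
  have us': "us \<in> walks proper normal_pair (length us)"
    using w walks_append[of us vs proper normal_pair] by (auto simp: walks_def)
  have D: "set us \<subseteq> D" "successively normal_pair us" "hd us \<noteq> \<Delta>"
    using us' hd_in_set[OF us] proper_simpleD unfolding walks_def by blast+
  have "head (prod_list us * (prod_list vs * a)) = hd us"
    using head_normal_prod[of "hd us" "tl us" "prod_list vs * a"] D us normal_pair by simp
  then have "\<not> \<Delta> \<preceq> ?y" using D left_gcd_absorb[of \<Delta> ?y] by (auto simp: mult.assoc)
  then have "remove_Delta \<Delta> ?y = ?y"
    by (intro remove_Delta_eq_self infimum_eq_0)
  then show "left_gcd (remove_Delta \<Delta> ?y) (\<Delta> ^ length us) = prod_list us"
    using Delta_power_gcd_normal_prod[OF D(1,2) normal_pair] by (simp add: mult.assoc)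
qed

text \<open>
  Now the product \<open>x a\<close> acquires a factor \<open>\<Delta>\<close>, whose removal conjugates the factors after it; their
  new normal form need not be computed. Let \<open>a' a = \<Delta>\<close>. The element \<open>z\<close> that remains after removing
  \<open>\<Delta>\<close> satisfies \<open>z a' = x\<close>, so \<open>z\<close> lies between \<open>prod_list us\<close> and \<open>x\<close> in the divisibility
  order. The gcds of these two with \<open>\<Delta> ^ length us\<close> agree, hence so does the gcd of \<open>z\<close>.
\<close>

lemma pd_le_if_Delta:
  assumes w: "us @ vs \<in> walks proper normal_pair k" and a: "a \<in> D" and Delta: "\<Delta> \<preceq> prod_list vs * a"
  shows "pd \<Delta> (prod_list (us @ vs)) a \<le> length vs"
proof (rule pd_le_if_prefix_stable[OF w], cases "us = []")
  case True
  then show "left_gcd (remove_Delta \<Delta> (prod_list (us @ vs) * a)) (\<Delta> ^ length us) = prod_list us"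
    by (simp add: left_gcd_one_right)
next
  case False
  define x g z where "x = prod_list (us @ vs)" and "g = prod_list us"
    and "z = remove_Delta \<Delta> (x * a)"
  obtain u where u: "u \<in> proper" "head x = u"
  proof -
    obtain u us' where "us = u # us'" using False by (cases us) auto
    then have "u \<in> proper" "head x = u"
      using w head_normal_form[of u "us' @ vs"] walk_is_normal_form[OF w]
      by (auto simp: walks_def x_def)
    then show thesis using that by blast
  qed
  have not: "\<not> \<Delta> \<preceq> x"
    using u proper_simpleD left_gcd_absorb[of \<Delta> x] by auto
  have "\<Delta> \<noteq> 1"
    using u(1) proper_simpleD[OF u(1)] by (auto simp: simple_iff_ld ld_one_iff)
  obtain r where r: "prod_list vs * a = \<Delta> * r"
    using Delta unfolding left_divides_def by metis
  have xa: "x * a = g * \<Delta> * r" by (simp add: x_def g_def mult.assoc r)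
  have "\<Delta> \<preceq> x * a"
    using Delta_commute(1)[of g] ld_mult[of \<Delta>] unfolding xa by (metis mult.assoc)
  then obtain m where m: "infimum \<Delta> (x * a) = Suc m"
    using infimum_pos \<open>\<Delta> \<noteq> 1\<close> gr0_implies_Suc by blast
  have z: "z * \<Delta> ^ m * \<Delta> = x * a"
    using remove_Delta_mult[of "x * a"] unfolding m z_def by (simp only: power_Suc2 mult.assoc)
  obtain a' where a': "\<Delta> = a' * a"
    using a by (auto simp: simple_iff_rd right_divided_by_def)
  have "z * \<Delta> ^ m * a' * a = x * a" using z unfolding mult.assoc a'[symmetric] .
  then have x: "z * \<Delta> ^ m * a' = x" by (rule right_cancel)
  \<comment> \<open>A second factor \<open>\<Delta>\<close> in \<open>x a\<close> would already divide \<open>x\<close>.\<close>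
  have "m = 0"
  proof (rule ccontr)
    assume "m \<noteq> 0"
    then obtain m' where m': "m = Suc m'" using not0_implies_Suc by blast
    obtain y where "z * \<Delta> ^ m = \<Delta> ^ m * y" using Delta_power_commute(1) by blast
    then have "x = \<Delta> * (\<Delta> ^ m' * y * a')"
      unfolding x[symmetric] m' power_Suc by (simp only: mult.assoc)
    then show False using not ld_mult by metis
  qed
  obtain r' where r': "\<Delta> * r = r' * \<Delta>" using Delta_commute(2) by blast
  have "z * \<Delta> = (g * r') * \<Delta>" using z \<open>m = 0\<close> r' xa by (simp add: mult.assoc)
  then have "z = g * r'" by (rule right_cancel)
  then have gz: "g \<preceq> z" using ld_mult by blast
  have zx: "z \<preceq> x" using x \<open>m = 0\<close> ld_mult[of z a'] by simp
  have g: "left_gcd x (\<Delta> ^ length us) = g"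
    unfolding x_def g_def by (rule Delta_power_gcd_walk[OF w])
  have "left_gcd z (\<Delta> ^ length us) = g"
  proof (rule left_gcd_eqI[OF gz])
    show "g \<preceq> \<Delta> ^ length us" using g left_gcd_ld(2) by metis
    show "e \<preceq> g" if "e \<preceq> z" "e \<preceq> \<Delta> ^ length us" for e
      using ld_left_gcd[OF ld_trans[OF that(1) zx] that(2)] g by simp
  qed
  then show "left_gcd (remove_Delta \<Delta> (prod_list (us @ vs) * a)) (\<Delta> ^ length us) = prod_list us"
    by (simp add: x_def g_def z_def)
qed

text \<open>
  Penetration sequences are walks as well. The condition \<open>m\<^sub>1 \<preceq> \<partial>s\<^sub>1\<close> can be imposed on all entries,
  since for the others it follows from \<open>m\<^sub>i\<^sub>+\<^sub>1 = gcd(\<partial>s\<^sub>i\<^sub>+\<^sub>1, s\<^sub>i m\<^sub>i)\<close>.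
\<close>

abbreviation pvertices :: "('a \<times> 'a) set"
  where "pvertices \<equiv> {(s, m). s \<in> proper \<and> m \<in> proper \<and> m \<preceq> compl s}"

abbreviation pedge :: "'a \<times> 'a \<Rightarrow> 'a \<times> 'a \<Rightarrow> bool"
  where "pedge \<equiv> \<lambda>(s', m') (s, m). s * m \<noteq> \<Delta> \<and> normal_pair s' s \<and> m' = left_gcd (compl s') (s * m)"

lemma PSeq_eq_walks: "PSeq \<Delta> k = walks pvertices pedge k"
proof -
  have "set w \<subseteq> pvertices" if "is_penetration_sequence \<Delta> w" for w
    using that
  proof (induction w)
    case (Cons p w)
    show ?case
    proof (cases w)
      case Nil
      then show ?thesis using Cons.prems by (cases p) (auto simp: is_penetration_sequence_def)
    next
      case (Cons q w')
      then have "is_penetration_sequence \<Delta> w"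
        using Cons.prems by (auto simp: is_penetration_sequence_def)
      then have "set w \<subseteq> pvertices" by (rule Cons.IH)
      moreover have "p \<in> pvertices"
        using Cons.prems Cons left_gcd_ld(1)
        by (cases p; cases q) (auto simp: is_penetration_sequence_def)
      ultimately show ?thesis by simp
    qed
  qed simp
  moreover have "snd (last w) \<preceq> compl (fst (last w))" if "set w \<subseteq> pvertices" "w \<noteq> []" for w
    using that(1) last_in_set[OF that(2)] by (auto simp: case_prod_unfold)
  ultimately show ?thesis
    by (fastforce simp: PSeq_def walks_def is_penetration_sequence_def)
qed

lemma finite_pvertices: "finite pvertices"
  by (rule finite_subset[of _ "proper \<times> proper"]) (auto simp: finite_proper_simple)

text \<open>
  The last conjunct is the invariant of the induction: the part absorbed by the current factor \<open>s\<close>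
  is \<open>m = gcd(\<partial>s, y)\<close>, where \<open>y\<close> is the whole product to the right of \<open>s\<close>. It gives
  \<open>s m = gcd(\<Delta>, s y)\<close>, so that \<open>m\<close> for the next factor depends on \<open>s m\<close> only, as penetration sequences
  require. The first \<open>m\<close> is a left divisor of the atom \<open>a\<close>, thus equal to \<open>a\<close> once it is not \<open>1\<close>.
\<close>

lemma penetration_sequence_exists:
  assumes "us @ vs \<in> walks proper normal_pair k" "vs \<noteq> []" "a \<in> atoms"
    and "length vs \<le> pd \<Delta> (prod_list (us @ vs)) a"
  shows "\<exists>w \<in> walks pvertices pedge (length vs). map fst w = vs \<and> snd (last w) = a \<and>
    snd (hd w) = left_gcd (compl (hd vs)) (prod_list (tl vs) * a)"
  using assms
proof (induction vs arbitrary: us)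
  case (Cons s vs)
  define m where "m = left_gcd (compl s) (prod_list vs * a)"
  have w: "(us @ [s]) @ vs \<in> walks proper normal_pair k" using Cons.prems by simp
  have s: "s \<in> proper" "s \<in> D" "s \<noteq> 1"
    using Cons.prems(1) proper_simpleD by (auto simp: walks_def)
  have pd: "length vs < pd \<Delta> (prod_list ((us @ [s]) @ vs)) a"
    using Cons.prems by simp
  have m1: "m \<noteq> 1"
    using pd_le_if_normal[OF w, of a] pd by (auto simp: m_def)
  have ms: "m \<preceq> compl s" unfolding m_def by (rule left_gcd_ld)
  then have "m \<preceq> \<Delta>" using compl_ld_Delta s ld_trans by blast
  moreover have "m \<noteq> \<Delta>"
    using ms ld_antisym[OF _ compl_ld_Delta[OF s(2)]] compl_eq_Delta_iff[OF s(2)] s(3) by metis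
  ultimately have m: "m \<in> proper"
    using m1 by (simp add: proper_simple_elements_def simple_iff_ld)
  show ?case
  proof (cases vs)
    case Nil
    then obtain c where c: "m * c = a"
      using left_gcd_ld(2)[of "compl s" a] by (auto simp: m_def left_divides_def)
    then have "c = 1" using Cons.prems(3) m1 unfolding atoms_def by blast
    then have "m = a" using c by simp
    then show ?thesis
      using Nil s m ms by (intro bexI[of _ "[(s, m)]"]) (auto simp: walks_def m_def)
  next
    case vs: (Cons t vs')
    obtain w' where w': "w' \<in> walks pvertices pedge (length vs)" "map fst w' = vs"
      "snd (last w') = a" "snd (hd w') = left_gcd (compl t) (prod_list vs' * a)"
      using Cons.IH[OF w] Cons.prems(3) pd vs by auto
    obtain n w'' where hd: "w' = (t, n) # w''" using w'(2,4) vs by (cases w') auto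
    have t: "t \<in> D" using Cons.prems(1) vs proper_simpleD by (auto simp: walks_def)
    have tn: "t * n = head (prod_list vs * a)"
      using w'(4) hd vs head_mult[OF t, of "prod_list vs' * a"] by (simp add: mult.assoc)
    have "t * n \<noteq> \<Delta>"
    proof
      assume "t * n = \<Delta>"
      then have "\<Delta> \<preceq> prod_list vs * a" using tn left_gcd_ld(2) by metis
      then show False
        using pd_le_if_Delta[OF w, of a] Cons.prems(3) atoms_subset_simple pd by auto
    qed
    moreover have "m = left_gcd (compl s) (t * n)"
      unfolding tn m_def using left_gcd_head compl_ld_Delta s by simp
    moreover have "normal_pair s t"
      using Cons.prems(1) vs by (auto simp: walks_def successively_append_iff)
    ultimately have "(s, m) # w' \<in> walks pvertices pedge (length (s # vs))"
      using w' s m ms hd by (auto simp: walks_def)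
    then show ?thesis
      using w' hd by (intro bexI[of _ "(s, m) # w'"]) (auto simp: m_def)
  qed
qed simp

end

section \<open>The expected penetration distance\<close>

lemma pair_pmf_of_set:
  assumes "finite A" "A \<noteq> {}" "finite B" "B \<noteq> {}"
  shows "pair_pmf (pmf_of_set A) (pmf_of_set B) = pmf_of_set (A \<times> B)"
proof (rule pmf_eqI)
  fix z
  show "pmf (pair_pmf (pmf_of_set A) (pmf_of_set B)) z = pmf (pmf_of_set (A \<times> B)) z"
    using assms by (cases z) (simp add: pmf_pair card_cartesian_product indicator_times)
qed

context garside_monoid
begin

text \<open>
  A pair is determined by the first \<open>k - p\<close> factors of \<open>x\<close> and a penetration sequence that contains
  both the last \<open>p\<close> factors and the atom.
\<close>

lemma card_pd_ge_le:
  assumes p: "1 \<le> p" "p \<le> k"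
  shows "card {(x, a). x \<in> length_sphere \<Delta> k \<and> a \<in> atoms \<and> p \<le> pd \<Delta> x a} \<le>
    card (walks proper normal_pair (k - p)) * card (walks pvertices pedge p)"
proof -
  let ?f = "\<lambda>(us, w). (prod_list (us @ map fst w), snd (last w))"
  have "{(x, a). x \<in> length_sphere \<Delta> k \<and> a \<in> atoms \<and> p \<le> pd \<Delta> x a} \<subseteq>
      ?f ` (walks proper normal_pair (k - p) \<times> walks pvertices pedge p)"
  proof clarify
    fix x a assume x: "x \<in> length_sphere \<Delta> k" and a: "a \<in> atoms" and pd: "p \<le> pd \<Delta> x a"
    obtain xs where xs: "xs \<in> walks proper normal_pair k" "x = prod_list xs"
      using x by (auto simp: length_sphere_eq)
    define us vs where "us = take (k - p) xs" and "vs = drop (k - p) xs"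
    have split: "xs = us @ vs" "length us = k - p" "length vs = p"
      using xs(1) p by (auto simp: us_def vs_def walks_def)
    have "us \<in> walks proper normal_pair (k - p)"
      using xs(1) split by (auto simp: walks_def successively_append_iff)
    moreover obtain w where "w \<in> walks pvertices pedge p" "map fst w = vs" "snd (last w) = a"
    proof -
      have "vs \<noteq> []" using split(3) p by auto
      then show thesis
        using penetration_sequence_exists[of us vs k a] xs split a pd that by blast
    qed
    ultimately show "(x, a) \<in> ?f ` (walks proper normal_pair (k - p) \<times> walks pvertices pedge p)"
      using xs split by (intro image_eqI[of _ _ "(us, w)"]) auto
  qed
  from surj_card_le[OF _ this] show ?thesis
    by (simp add: finite_walks finite_pvertices finite_proper_simple card_cartesian_product)
qed

lemma pd_le_k: "x \<in> length_sphere \<Delta> k \<Longrightarrow> pd \<Delta> x a \<le> k"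
  by (simp add: pd_def length_sphere_def)

lemma sum_pd_le:
  "(\<Sum>(x, a) \<in> length_sphere \<Delta> k \<times> atoms. pd \<Delta> x a) \<le>
    (\<Sum>p=1..k. card (walks proper normal_pair (k - p)) * card (walks pvertices pedge p))"
proof -
  let ?S = "length_sphere \<Delta> k \<times> (atoms :: 'a set)"
  have fin: "finite ?S"
    using finite_length_sphere finite_simple finite_subset[OF atoms_subset_simple] by blast
  have "(\<Sum>(x, a) \<in> ?S. pd \<Delta> x a) = (\<Sum>z\<in>?S. \<Sum>p=1..k. of_bool (p \<le> pd \<Delta> (fst z) (snd z)))"
  proof (rule sum.cong[OF refl], clarify)
    fix x a :: 'a assume x: "x \<in> length_sphere \<Delta> k"
    have "{1..k} \<inter> {p. p \<le> pd \<Delta> x a} = {1..pd \<Delta> x a}" using pd_le_k[OF x, of a] by auto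
    then show "pd \<Delta> x a = (\<Sum>p=1..k. of_bool (p \<le> pd \<Delta> (fst (x, a)) (snd (x, a))))"
      by (simp add: sum_of_bool_eq)
  qed
  also have "\<dots> = (\<Sum>p=1..k. \<Sum>z\<in>?S. of_bool (p \<le> pd \<Delta> (fst z) (snd z)))"
    by (rule sum.swap)
  also have "\<dots> = (\<Sum>p=1..k. card {(x, a). x \<in> length_sphere \<Delta> k \<and> a \<in> atoms \<and> p \<le> pd \<Delta> x a})"
    using fin by (intro sum.cong refl) (auto simp: sum_of_bool_eq intro!: arg_cong[of _ _ card])
  also have "\<dots> \<le> (\<Sum>p=1..k. card (walks proper normal_pair (k - p)) * card (walks pvertices pedge p))"
    by (intro sum_mono card_pd_ge_le) auto
  finally show ?thesis .
qed

text \<open>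
  The strict inequality of growth rates also excludes the degenerate cases: it forces \<open>\<beta> > 0\<close>, so
  that all spheres are nonempty and there is an atom.
\<close>

lemma expected_pd_bounded:
  assumes less: "PSeq_growth_rate \<Delta> < sphere_growth_rate \<Delta>"
  shows "\<exists>C :: real. \<forall>k. measure_pmf.expectation
      (pair_pmf (pmf_of_set (length_sphere \<Delta> k)) (pmf_of_set (atoms :: 'a set)))
      (\<lambda>(x, a). real (pd \<Delta> x a)) \<le> C"
proof -
  obtain \<beta> where \<beta>: "(\<lambda>n. root n (real (card (walks proper normal_pair n)))) \<longlonglongrightarrow> \<beta>"
    "\<And>n. \<beta> ^ n \<le> real (card (walks proper normal_pair n))"
    by (rule walks_growth_rate[OF finite_proper_simple, of normal_pair]) (rule that)
  obtain \<alpha> where \<alpha>: "(\<lambda>n. root n (real (card (walks pvertices pedge n)))) \<longlonglongrightarrow> \<alpha>" "0 \<le> \<alpha>"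
    "\<And>c. \<alpha> < c \<Longrightarrow> \<exists>K>0. \<forall>n. real (card (walks pvertices pedge n)) \<le> K * c ^ n"
    by (rule walks_growth_rate[OF finite_pvertices, of pedge]) (rule that)
  have "\<alpha> < \<beta>"
    using less limI[OF \<alpha>(1)] limI[OF \<beta>(1)]
    by (simp add: PSeq_growth_rate_def sphere_growth_rate_def PSeq_eq_walks card_length_sphere)
  then obtain g g' where g: "\<alpha> < g'" "g' < g" "g < \<beta>" using dense by meson
  obtain K where K: "K > 0" "\<And>n. real (card (walks pvertices pedge n)) \<le> K * g' ^ n"
    using \<alpha>(3)[OF g(1)] by blast
  obtain c where c: "c > 0"
    "\<And>k p. c * g ^ p * real (card (walks proper normal_pair k)) \<le> real (card (walks proper normal_pair (k + p)))"
    using card_walks_growth[OF finite_proper_simple \<beta>(2), of g] g \<alpha>(2) by auto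
  have pos: "0 < g'" "0 < g" "0 < \<beta>" using g \<alpha>(2) by linarith+
  define q where "q = g' / g"
  have q: "0 \<le> q" "q < 1" using pos g by (auto simp: q_def)
  have sphere: "length_sphere \<Delta> k \<noteq> {}" for k
  proof -
    have "0 < \<beta> ^ k" using pos by simp
    also have "\<dots> \<le> real (card (length_sphere \<Delta> k))"
      using \<beta>(2)[of k] by (simp add: card_length_sphere)
    finally show ?thesis by auto
  qed
  have atoms: "(atoms :: 'a set) \<noteq> {}" "finite (atoms :: 'a set)"
  proof -
    obtain xs where "xs \<in> walks proper normal_pair 1"
      using sphere[of 1] by (auto simp: length_sphere_eq)
    then obtain s where "s \<in> proper" by (cases xs) (auto simp: walks_def)
    then show "(atoms :: 'a set) \<noteq> {}" using atoms_nonempty proper_simpleD by blast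
    show "finite (atoms :: 'a set)" using finite_simple atoms_subset_simple finite_subset by blast
  qed
  have "measure_pmf.expectation
      (pair_pmf (pmf_of_set (length_sphere \<Delta> k)) (pmf_of_set (atoms :: 'a set)))
      (\<lambda>(x, a). real (pd \<Delta> x a)) \<le> K / (c * (1 - q))" for k
  proof -
    let ?S = "length_sphere \<Delta> k \<times> (atoms :: 'a set)"
    define w where "w = real (card (walks proper normal_pair k))"
    have w: "0 < w"
      using sphere[of k] finite_length_sphere[of k] by (simp add: w_def card_gt_0_iff flip: card_length_sphere)
    have summand_le: "real (card (walks proper normal_pair (k - p)) * card (walks pvertices pedge p)) \<le> w * K / c * q ^ p"
      if p: "p \<in> {1..k}" for p
    proof -
      have "real (card (walks proper normal_pair (k - p))) \<le> w / (c * g ^ p)"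
        using c(2)[of p "k - p"] p c(1) pos by (simp add: w_def field_simps)
      then have "real (card (walks proper normal_pair (k - p)) * card (walks pvertices pedge p)) \<le>
          w / (c * g ^ p) * (K * g' ^ p)"
        unfolding of_nat_mult using w c(1) pos by (intro mult_mono K) auto
      also have "\<dots> = w * K / c * q ^ p" by (simp add: q_def power_divide)
      finally show ?thesis .
    qed
    have "real (\<Sum>(x, a) \<in> ?S. pd \<Delta> x a) \<le>
        real (\<Sum>p=1..k. card (walks proper normal_pair (k - p)) * card (walks pvertices pedge p))"
      using sum_pd_le by (rule of_nat_mono)
    also have "\<dots> \<le> (\<Sum>p=1..k. w * K / c * q ^ p)"
      unfolding of_nat_sum by (rule sum_mono[OF summand_le])
    also have "\<dots> = w * K / c * (\<Sum>p=1..k. q ^ p)" by (simp add: sum_distrib_left)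
    also have "\<dots> \<le> w * K / c * (1 / (1 - q))"
    proof (rule mult_left_mono)
      have "(\<Sum>p=1..k. q ^ p) \<le> (\<Sum>p. q ^ p)"
        by (rule sum_le_suminf) (use q in \<open>auto intro: summable_geometric\<close>)
      then show "(\<Sum>p=1..k. q ^ p) \<le> 1 / (1 - q)" using q by (simp add: suminf_geometric)
    qed (use w K c in auto)
    finally have sum: "real (\<Sum>(x, a) \<in> ?S. pd \<Delta> x a) \<le> w * (K / (c * (1 - q)))" by simp
    have card1: "1 \<le> real (card (atoms :: 'a set))"
      using atoms by (simp add: Suc_le_eq card_gt_0_iff)
    have "measure_pmf.expectation
        (pair_pmf (pmf_of_set (length_sphere \<Delta> k)) (pmf_of_set (atoms :: 'a set)))
        (\<lambda>(x, a). real (pd \<Delta> x a)) = real (\<Sum>(x, a) \<in> ?S. pd \<Delta> x a) / card ?S"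
      using sphere[of k] finite_length_sphere[of k] atoms
      by (simp add: pair_pmf_of_set integral_pmf_of_set case_prod_unfold)
    also have "\<dots> \<le> w * (K / (c * (1 - q))) / (w * card (atoms :: 'a set))"
    proof -
      have "real (card ?S) = w * card (atoms :: 'a set)"
        by (simp add: card_cartesian_product card_length_sphere w_def)
      then show ?thesis using sum w by (simp only:) (intro divide_right_mono, auto)
    qed
    also have "\<dots> = K / (c * (1 - q)) / card (atoms :: 'a set)" using w by simp
    also have "\<dots> \<le> K / (c * (1 - q)) / 1"
      using card1 K c q by (intro divide_left_mono) auto
    finally show ?thesis by simp
  qed
  then show ?thesis by blast
qed

end

theorem theorem4p7:
  fixes \<Delta> :: "'a::monoid_mult"
  assumes "garside_monoid \<Delta>"
    and "PSeq_growth_rate \<Delta> < sphere_growth_rate \<Delta>"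
  shows "\<exists>C :: real. \<forall>k :: nat.
    measure_pmf.expectation
      (pair_pmf (pmf_of_set (length_sphere \<Delta> k)) (pmf_of_set (atoms :: 'a set)))
      (\<lambda>(x, a). real (pd \<Delta> x a)) \<le> C"
  using garside_monoid.expected_pd_bounded[OF assms] .

end
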